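(* Let $r\ge1$ and let $\lambda=(\lambda_1\ge\cdots\ge\lambda_r\ge0)$ be a partition. The partition functions of the uncolored bosonic models with $P$- and $R$-weights equal the Hall-Littlewood $P$- and $R$-polynomials: $$Z_P(\mathfrak S_\lambda^{\mathrm{unc}}(\mathbf z;t))=P_\lambda(z_1,\dots,z_r;t),\qquad Z_R(\mathfrak S_\lambda^{\mathrm{unc}}(\mathbf z;t))=R_\lambda(z_1,\dots,z_r;t).$$
   Context: Hall-Littlewood polynomials: with $S_r$ permuting the variables, $$R_\lambda(z_1,\dots,z_r;t)=\sum_{w\in S_r}w\left(z_1^{\lambda_1}\cdots z_r^{\lambda_r}\prod_{i<j}\frac{z_i-tz_j}{z_i-z_j}\right),\qquad P_\lambda=\frac{1}{v_\lambda(t)}R_\lambda,$$ where $v_\lambda(t)=\prod_{i\ge0}\prod_{k=1}^{m_i}\frac{1-t^k}{1-t}$ and $m_i=\#\{k\in\{1,\dots,r\}:\lambda_k=i\}$ (including $i=0$). Uncolored bosonic model. Let $\mathbf z=(z_1,\dots,z_r)$ and $t$ be indeterminates. Fix an integer $N\ge\lambda_1$ and take a rectangular grid with $r$ rows, labeled $1,\dots,r$ from top to bottom, and $N+1$ columns, labeled $0,1,\dots,N$ from right to left. Horizontal edges carry spins in $\{+,-\}$, vertical edges carry spins in $\mathbb N=\{0,1,2,\dots\}$. The Boltzmann weight of a vertex in row $i$ with spins (left, top, right, bottom) is, for $n\in\mathbb N$: - $(+,n,+,n)$: $1$ for both the $P$- and $R$-weights; - $(-,n,-,n)$: $z_i$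 for both the $P$- and $R$-weights; - $(-,n,+,n+1)$: $P$-weight $z_i(1-t^{n+1})$; $R$-weight $z_i(1-t)$; - $(+,n+1,-,n)$: $P$-weight $1$; $R$-weight $\frac{1-t^{n+1}}{1-t}$; and every other configuration has weight $0$. Boundary spins are fixed: every left boundary edge is $+$, every right boundary edge is $-$, every bottom boundary edge is $0$, and the top boundary edge of column $j$ is $m_j$. A state assigns spins to all interior edges; its Boltzmann weight is the product of the weights of all vertices. $Z_P$ (resp. $Z_R$) is the sum of the Boltzmann weights of all states using the $P$-weights (resp. $R$-weights); it does not depend on $N\ge\lambda_1$. *)

theory Defs
  imports
    "HOL-Library.Poly_Mapping"
    "HOL-Library.FuncSet"
    "HOL-Computational_Algebra.Fraction_Field"
    "HOL-Combinatorics.Permutations"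
begin

text \<open>
  Polynomials in countably many variables over an integral domain are finitely supported maps
  from monomials (exponent vectors) to coefficients; \<open>ratfun\<close> is their fraction field.  One
  variable serves as \<open>t\<close> and the others as \<open>z\<^sub>0, z\<^sub>1, z\<^sub>2, \<dots>\<close>; a statement about \<open>r\<close> variables only
  involves \<open>z\<^sub>1, \<dots>, z\<^sub>r\<close>.
\<close>

type_synonym 'k ratfun = "((nat \<Rightarrow>\<^sub>0 nat) \<Rightarrow>\<^sub>0 'k) fract"

definition indet :: "nat \<Rightarrow> 'k::idom ratfun" where
  "indet n = Fract (Poly_Mapping.single (Poly_Mapping.single n 1) 1) 1"

definition tvar :: "'k::idom ratfun" where
  "tvar = indet 0"

definition zvar :: "nat \<Rightarrow> 'k::idom ratfun" where
  "zvar i = indet (Suc i)"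

text \<open>
  A partition with \<open>r\<close> parts (zero parts allowed) is a function on \<open>{1..r}\<close> that is weakly
  decreasing there.  The polynomials are defined for arguments \<open>z\<close>, \<open>t\<close> in any field, so that a
  permutation of the variables is precomposition of \<open>z\<close>; the denominators are nonzero when the
  arguments are indeterminates.
\<close>

definition mult_of :: "nat \<Rightarrow> (nat \<Rightarrow> nat) \<Rightarrow> nat \<Rightarrow> nat" where
  "mult_of r lam i = card {k \<in> {1..r}. lam k = i}"

definition HL_summand :: "nat \<Rightarrow> (nat \<Rightarrow> nat) \<Rightarrow> (nat \<Rightarrow> 'a::field) \<Rightarrow> 'a \<Rightarrow> 'a" where
  "HL_summand r lam z t =
     (\<Prod>i\<in>{1..r}. z i ^ lam i) * (\<Prod>i\<in>{1..r}. \<Prod>j\<in>{i<..r}. (z i - t * z j) / (z i - z j))"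

definition HL_R :: "nat \<Rightarrow> (nat \<Rightarrow> nat) \<Rightarrow> (nat \<Rightarrow> 'a::field) \<Rightarrow> 'a \<Rightarrow> 'a" where
  "HL_R r lam z t = (\<Sum>w | w permutes {1..r}. HL_summand r lam (z \<circ> w) t)"

text \<open>
  The factors of the product over all \<open>i \<ge> 0\<close> with \<open>i > lam 1\<close> are empty products, because
  \<open>lam 1\<close> is the largest part.
\<close>

definition HL_v :: "nat \<Rightarrow> (nat \<Rightarrow> nat) \<Rightarrow> 'a::field \<Rightarrow> 'a" where
  "HL_v r lam t = (\<Prod>i\<in>{0..lam 1}. \<Prod>k\<in>{1..mult_of r lam i}. (1 - t ^ k) / (1 - t))"

definition HL_P :: "nat \<Rightarrow> (nat \<Rightarrow> nat) \<Rightarrow> (nat \<Rightarrow> 'a::field) \<Rightarrow> 'a \<Rightarrow> 'a" where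
  "HL_P r lam z t = 1 / HL_v r lam t * HL_R r lam z t"

datatype hspin = Plus | Minus

text \<open>The arguments of a weight are \<open>z\<^sub>i\<close>, \<open>t\<close> and the left, top, right and bottom spins.\<close>

type_synonym 'a vertex_weight = "'a \<Rightarrow> 'a \<Rightarrow> hspin \<Rightarrow> nat \<Rightarrow> hspin \<Rightarrow> nat \<Rightarrow> 'a"

fun P_weight :: "'a::field vertex_weight" where
  "P_weight z t Plus n Plus n' = (if n' = n then 1 else 0)"
| "P_weight z t Minus n Minus n' = (if n' = n then z else 0)"
| "P_weight z t Minus n Plus n' = (if n' = n + 1 then z * (1 - t ^ (n + 1)) else 0)"
| "P_weight z t Plus n Minus n' = (if n = n' + 1 then 1 else 0)"

fun R_weight :: "'a::field vertex_weight" where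
  "R_weight z t Plus n Plus n' = (if n' = n then 1 else 0)"
| "R_weight z t Minus n Minus n' = (if n' = n then z else 0)"
| "R_weight z t Minus n Plus n' = (if n' = n + 1 then z * (1 - t) else 0)"
| "R_weight z t Plus n Minus n' = (if n = n' + 1 then (1 - t ^ (n' + 1)) / (1 - t) else 0)"

text \<open>
  A state is a pair \<open>(h, v)\<close>.  Rows \<open>1, \<dots>, r\<close> run from top to bottom and columns \<open>0, \<dots>, N\<close> from
  right to left.  The vertex in row \<open>i\<close> and column \<open>j\<close> has left edge \<open>h (i, j + 1)\<close>, top edge
  \<open>v (i - 1, j)\<close>, right edge \<open>h (i, j)\<close> and bottom edge \<open>v (i, j)\<close>.  Both functions are
  \<open>undefined\<close> off the grid, so that each assignment of spins is a single state.
\<close>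

type_synonym state = "(nat \<times> nat \<Rightarrow> hspin) \<times> (nat \<times> nat \<Rightarrow> nat)"

definition states :: "nat \<Rightarrow> nat \<Rightarrow> (nat \<Rightarrow> nat) \<Rightarrow> state set" where
  "states r N lam =
     {(h, v). h \<in> {1..r} \<times> {0..N + 1} \<rightarrow>\<^sub>E UNIV \<and>
              v \<in> {0..r} \<times> {0..N} \<rightarrow>\<^sub>E UNIV \<and>
              (\<forall>i\<in>{1..r}. h (i, N + 1) = Plus \<and> h (i, 0) = Minus) \<and>
              (\<forall>j\<in>{0..N}. v (0, j) = mult_of r lam j \<and> v (r, j) = 0)}"

fun boltzmann ::
    "'a::field vertex_weight \<Rightarrow> nat \<Rightarrow> nat \<Rightarrow> (nat \<Rightarrow> 'a) \<Rightarrow> 'a \<Rightarrow> state \<Rightarrow> 'a" where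
  "boltzmann wt r N z t (h, v) =
     (\<Prod>i\<in>{1..r}. \<Prod>j\<in>{0..N}. wt (z i) t (h (i, j + 1)) (v (i - 1, j)) (h (i, j)) (v (i, j)))"

text \<open>
  For \<open>r \<ge> 2\<close> there are infinitely many states, but only finitely many have nonzero weight
  (\<open>finite_support\<close> below); \<^const>\<open>sum\<close> over an infinite set would be 0, so the partition function
  sums over the states of nonzero weight.
\<close>

definition partition_function ::
    "'a::field vertex_weight \<Rightarrow> nat \<Rightarrow> nat \<Rightarrow> (nat \<Rightarrow> nat) \<Rightarrow> (nat \<Rightarrow> 'a) \<Rightarrow> 'a \<Rightarrow> 'a" where
  "partition_function wt r N lam z t =
     (\<Sum>s | s \<in> states r N lam \<and> boltzmann wt r N z t s \<noteq> 0. boltzmann wt r N z t s)"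

definition Z_P :: "nat \<Rightarrow> nat \<Rightarrow> (nat \<Rightarrow> nat) \<Rightarrow> (nat \<Rightarrow> 'a::field) \<Rightarrow> 'a \<Rightarrow> 'a" where
  "Z_P = partition_function P_weight"

definition Z_R :: "nat \<Rightarrow> nat \<Rightarrow> (nat \<Rightarrow> nat) \<Rightarrow> (nat \<Rightarrow> 'a::field) \<Rightarrow> 'a \<Rightarrow> 'a" where
  "Z_R = partition_function R_weight"

lemma finite_support:
  fixes wt :: "'a::field vertex_weight"
  assumes wt: "\<And>z t a n b n'. wt z t a n b n' \<noteq> 0 \<Longrightarrow> n' \<le> n + 1"
  shows "finite {s \<in> states r N lam. boltzmann wt r N z t s \<noteq> 0}"
proof -
  define M where "M = (\<Sum>j\<in>{0..N}. mult_of r lam j) + r"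
  let ?H = "{1..r} \<times> {0..N + 1} \<rightarrow>\<^sub>E (UNIV :: hspin set)"
  let ?V = "{0..r} \<times> {0..N} \<rightarrow>\<^sub>E {0..M}"
  have hspin: "(UNIV :: hspin set) = {Plus, Minus}"
    using hspin.exhaust by auto
  have "finite ?H" by (intro finite_PiE) (auto simp: hspin)
  moreover have "finite ?V" by (intro finite_PiE) auto
  moreover have "{s \<in> states r N lam. boltzmann wt r N z t s \<noteq> 0} \<subseteq> ?H \<times> ?V"
  proof (clarify, rule conjI)
    fix h v assume s: "(h, v) \<in> states r N lam" and nz: "boltzmann wt r N z t (h, v) \<noteq> 0"
    from s show "h \<in> ?H" by (simp add: states_def)
    have step: "v (i, j) \<le> v (i - 1, j) + 1" if "i \<in> {1..r}" "j \<in> {0..N}" for i j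
    proof -
      have "wt (z i) t (h (i, j + 1)) (v (i - 1, j)) (h (i, j)) (v (i, j)) \<noteq> 0"
        using nz that by (auto simp: prod_zero_iff)
      then show ?thesis by (rule wt)
    qed
    have bound: "v (i, j) \<le> mult_of r lam j + i" if "i \<le> r" "j \<in> {0..N}" for i j
      using that(1)
    proof (induction i)
      case 0
      then show ?case using s that(2) by (auto simp: states_def)
    next
      case (Suc i)
      then show ?case using step[of "Suc i" j] that(2) by auto
    qed
    have "mult_of r lam j + i \<le> M" if "i \<le> r" "j \<in> {0..N}" for i j
      unfolding M_def using that member_le_sum[of j "{0..N}" "mult_of r lam"]
      by (intro add_mono) auto
    with bound have "v (i, j) \<le> M" if "i \<le> r" "j \<in> {0..N}" for i j
      using that order_trans by blast
    moreover have "v \<in> {0..r} \<times> {0..N} \<rightarrow>\<^sub>E UNIV" using s by (simp add: states_def)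
    ultimately show "v \<in> ?V" by (auto simp: PiE_iff)
  qed
  ultimately show ?thesis by (meson finite_SigmaI finite_subset)
qed

lemma P_weight_bound: "P_weight z t a n b n' \<noteq> 0 \<Longrightarrow> n' \<le> n + 1"
  by (cases a; cases b) (auto split: if_splits)

lemma R_weight_bound: "R_weight z t a n b n' \<noteq> 0 \<Longrightarrow> n' \<le> n + 1"
  by (cases a; cases b) (auto split: if_splits)

lemma finite_support_P: "finite {s \<in> states r N lam. boltzmann P_weight r N z t s \<noteq> 0}"
  by (rule finite_support) (rule P_weight_bound)

lemma finite_support_R: "finite {s \<in> states r N lam. boltzmann R_weight r N z t s \<noteq> 0}"
  by (rule finite_support) (rule R_weight_bound)

end

theory Submission
  imports Defs
begin

text \<open>
  Both sides satisfy the same branching rule, obtained by removing the top row, that is, the variable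
  \<open>x = z\<^sub>1\<close>.  In \<open>R\<^sub>\<lambda>\<close>, sorting the permutations by the position \<open>p\<close> of \<open>x\<close> gives the symmetrization,
  in the remaining variables \<open>y\<close>, of the sum over \<open>p\<close> of
  \<open>x^\<lambda>\<^sub>p\<close> times factors \<open>y\<^sub>k^\<lambda>\<^sub>k (y\<^sub>k - t x) / (y\<^sub>k - x)\<close> for \<open>k < p\<close> and
  \<open>y\<^sub>k^\<lambda>\<^bsub>k+1\<^esub> (x - t y\<^sub>k) / (x - y\<^sub>k)\<close> for \<open>k \<ge> p\<close>.
  In the lattice model, the top row sends the multiplicities of \<open>\<lambda>\<close> to those of a partition \<open>\<mu>\<close> with one part
  less, and each \<open>\<mu>\<close> contributes its weight times \<open>R\<^sub>\<mu>(y)\<close>, the symmetrization of \<open>y^\<mu>\<close>.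
  Summing over \<open>\<mu>\<close> before symmetrizing, column by column from the left, is a transfer computation
  with two states, the spin of the current horizontal edge.  Modulo functions that the
  symmetrization annihilates, both partial sums have closed forms that evolve part by part, and at
  the right boundary the partial sum with spin \<open>-\<close> is the above sum over \<open>p\<close>.

  The \<open>R\<close>-weight of a vertex is its \<open>P\<close>-weight times a factor depending on the top spin, divided by
  the same factor of the bottom spin.  In the product over a state this telescopes to \<open>v\<^sub>\<lambda>(t)\<close>.
\<close>

subsection \<open>Inserting a variable into the symmetrization\<close>

definition HL_cross :: "nat \<Rightarrow> 'a::field \<Rightarrow> (nat \<Rightarrow> 'a) \<Rightarrow> 'a" where
  "HL_cross n t y = (\<Prod>i\<in>{1..n}. \<Prod>j\<in>{i<..n}. (y i - t * y j) / (y i - y j))"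

lemma HL_summand_cross: "HL_summand n lam y t = (\<Prod>i\<in>{1..n}. y i ^ lam i) * HL_cross n t y"
  by (simp add: HL_summand_def HL_cross_def)

lemma HL_cross_Suc:
  "HL_cross (Suc n) t y
     = HL_cross n t y * (\<Prod>i\<in>{1..n}. (y i - t * y (Suc n)) / (y i - y (Suc n)))"
proof -
  have "{i<..Suc n} = insert (Suc n) {i<..n}" if "i \<in> {1..n}" for i
    using that by auto
  then have "(\<Prod>i\<in>{1..n}. \<Prod>j\<in>{i<..Suc n}. (y i - t * y j) / (y i - y j))
     = (\<Prod>i\<in>{1..n}. (\<Prod>j\<in>{i<..n}. (y i - t * y j) / (y i - y j)) * ((y i - t * y (Suc n)) / (y i - y (Suc n))))"
    by (intro prod.cong refl) (simp add: mult.commute)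
  also have "\<dots> = HL_cross n t y * (\<Prod>i\<in>{1..n}. (y i - t * y (Suc n)) / (y i - y (Suc n)))"
    unfolding HL_cross_def prod.distrib ..
  finally show ?thesis
    by (simp add: HL_cross_def)
qed

lemma HL_cross_cong: "(\<And>i. i \<in> {1..n} \<Longrightarrow> y i = y' i) \<Longrightarrow> HL_cross n t y = HL_cross n t y'"
  unfolding HL_cross_def by (intro prod.cong refl) auto

lemma HL_summand_cong:
  "(\<And>i. i \<in> {1..n} \<Longrightarrow> y i = y' i) \<Longrightarrow> HL_summand n lam y t = HL_summand n lam y' t"
  unfolding HL_summand_cross by (intro arg_cong2[where f = "(*)"] prod.cong HL_cross_cong) auto

lemma HL_summand_Suc:
  "HL_summand (Suc n) lam y t = HL_summand n lam y t * y (Suc n) ^ lam (Suc n)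
     * (\<Prod>i\<in>{1..n}. (y i - t * y (Suc n)) / (y i - y (Suc n)))"
  by (simp add: HL_summand_cross HL_cross_Suc)

definition ins_at :: "nat \<Rightarrow> 'a \<Rightarrow> (nat \<Rightarrow> 'a) \<Rightarrow> nat \<Rightarrow> 'a" where
  "ins_at p x y i = (if i < p then y i else if i = p then x else y (i - 1))"

lemma prod_ins_at:
  fixes F :: "'a \<Rightarrow> 'b::comm_monoid_mult"
  assumes "p \<in> {1..Suc n}"
  shows "(\<Prod>i\<in>{1..Suc n}. F (ins_at p x y i)) = F x * (\<Prod>i\<in>{1..n}. F (y i))"
  using assms
proof (induction n)
  case 0
  then show ?case by (simp add: ins_at_def)
next
  case (Suc n)
  show ?case
  proof (cases "p = Suc (Suc n)")
    case True
    then have "(\<Prod>i\<in>{1..Suc n}. F (ins_at p x y i)) = (\<Prod>i\<in>{1..Suc n}. F (y i))"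
      by (intro prod.cong) (auto simp: ins_at_def)
    with True show ?thesis
      by (subst prod.nat_ivl_Suc') (auto simp: ins_at_def)
  next
    case False
    with Suc have "(\<Prod>i\<in>{1..Suc n}. F (ins_at p x y i)) = F x * (\<Prod>i\<in>{1..n}. F (y i))"
      by auto
    moreover have "ins_at p x y (Suc (Suc n)) = y (Suc n)"
      using False Suc.prems by (auto simp: ins_at_def)
    ultimately show ?thesis
      by (subst prod.nat_ivl_Suc') (auto simp: ac_simps)
  qed
qed

text \<open>The factors of the variables in front of \<open>x\<close> when \<open>x\<close> has
  position \<open>L + 1\<close>, without the cross factors among these variables.\<close>

definition before_part :: "(nat \<Rightarrow> nat) \<Rightarrow> 'a::field \<Rightarrow> 'a \<Rightarrow> nat \<Rightarrow> (nat \<Rightarrow> 'a) \<Rightarrow> 'a" where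
  "before_part lam x t L y = (\<Prod>k\<in>{1..L}. y k ^ lam k * ((y k - t * x) / (y k - x)))"

text \<open>
  In \<open>insert_sum lam x t L\<close> the variable \<open>x\<close> is inserted among \<open>y 1, \<dots>, y (L - 1)\<close>; the last factor is
  that of the variable \<open>y L\<close>, which passes from position \<open>L\<close> to position \<open>L + 1\<close>.
\<close>
primrec insert_sum :: "(nat \<Rightarrow> nat) \<Rightarrow> 'a::field \<Rightarrow> 'a \<Rightarrow> nat \<Rightarrow> (nat \<Rightarrow> 'a) \<Rightarrow> 'a" where
  "insert_sum lam x t 0 y = 0"
| "insert_sum lam x t (Suc L) y = x ^ lam (Suc L) * before_part lam x t L y
     + insert_sum lam x t L y * (y L ^ lam (Suc L) * ((x - t * y L) / (x - y L)))"

text \<open>Induction on the number of variables. The last position of \<open>x\<close> gives the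
  first summand in the recursion of \<open>insert_sum\<close>. At every other position
  \<open>y (Suc n)\<close> comes last, and by \<open>prod_ins_at\<close> its cross factors do not
  depend on \<open>p\<close>.\<close>

lemma sum_HL_summand_ins_at:
  "(\<Sum>p\<in>{1..Suc n}. HL_summand (Suc n) lam (ins_at p x y) t)
     = insert_sum lam x t (Suc n) y * HL_cross n t y"
proof (induction n)
  case 0
  then show ?case by (simp add: HL_summand_cross HL_cross_def before_part_def ins_at_def)
next
  case (Suc n)
  have last: "HL_summand (Suc (Suc n)) lam (ins_at (Suc (Suc n)) x y) t
      = x ^ lam (Suc (Suc n)) * before_part lam x t (Suc n) y * HL_cross (Suc n) t y"
  proof -
    have "HL_summand (Suc n) lam (ins_at (Suc (Suc n)) x y) t = HL_summand (Suc n) lam y t"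
      by (rule HL_summand_cong) (auto simp: ins_at_def)
    moreover have "(\<Prod>i\<in>{1..Suc n}. (ins_at (Suc (Suc n)) x y i - t * x) / (ins_at (Suc (Suc n)) x y i - x))
       = (\<Prod>i\<in>{1..Suc n}. (y i - t * x) / (y i - x))"
      by (intro prod.cong) (auto simp: ins_at_def)
    moreover have "ins_at (Suc (Suc n)) x y (Suc (Suc n)) = x" by (simp add: ins_at_def)
    ultimately show ?thesis
      unfolding HL_summand_Suc[of "Suc n"] before_part_def prod.distrib
      by (simp only: HL_summand_cross ac_simps)
  qed
  have rest: "HL_summand (Suc (Suc n)) lam (ins_at p x y) t
      = HL_summand (Suc n) lam (ins_at p x y) t * (y (Suc n) ^ lam (Suc (Suc n)) *
        ((x - t * y (Suc n)) / (x - y (Suc n)) * (\<Prod>i\<in>{1..n}. (y i - t * y (Suc n)) / (y i - y (Suc n)))))"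
    if "p \<in> {1..Suc n}" for p
  proof -
    have "ins_at p x y (Suc (Suc n)) = y (Suc n)" using that by (auto simp: ins_at_def)
    then show ?thesis
      unfolding HL_summand_Suc[of "Suc n"]
      by (simp only: prod_ins_at[OF that, of "\<lambda>u. (u - t * y (Suc n)) / (u - y (Suc n))"] mult.assoc)
  qed
  have "(\<Sum>p\<in>{1..Suc (Suc n)}. HL_summand (Suc (Suc n)) lam (ins_at p x y) t)
     = HL_summand (Suc (Suc n)) lam (ins_at (Suc (Suc n)) x y) t
       + (\<Sum>p\<in>{1..Suc n}. HL_summand (Suc (Suc n)) lam (ins_at p x y) t)"
    by (subst sum.nat_ivl_Suc') auto
  also have "(\<Sum>p\<in>{1..Suc n}. HL_summand (Suc (Suc n)) lam (ins_at p x y) t)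
     = (\<Sum>p\<in>{1..Suc n}. HL_summand (Suc n) lam (ins_at p x y) t) * (y (Suc n) ^ lam (Suc (Suc n)) *
        ((x - t * y (Suc n)) / (x - y (Suc n)) * (\<Prod>i\<in>{1..n}. (y i - t * y (Suc n)) / (y i - y (Suc n)))))"
    unfolding sum_distrib_right by (intro sum.cong refl rest)
  finally show ?case
    unfolding Suc.IH last HL_cross_Suc insert_sum.simps(2)[of _ _ _ "Suc n"]
    by (simp only: ring_distribs ac_simps)
qed

text \<open>Index 0 is set apart because a permutation of \<open>{1..Suc n}\<close> has to fix it,
  while \<open>ins_at\<close> would return \<open>Suc (w 0)\<close>.\<close>

definition ins_perm :: "nat \<Rightarrow> (nat \<Rightarrow> nat) \<Rightarrow> nat \<Rightarrow> nat" where
  "ins_perm p w i = (if i = 0 then 0 else ins_at p 1 (Suc \<circ> w) i)"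

lemma ins_perm_skip:
  "i \<noteq> p \<Longrightarrow> 0 < i \<Longrightarrow> ins_perm p w i = Suc (w (if i < p then i else i - 1))"
  by (simp add: ins_perm_def ins_at_def)

lemma ins_perm_at: "0 < p \<Longrightarrow> ins_perm p w p = 1"
  by (simp add: ins_perm_def ins_at_def)

lemma ins_perm_permutes:
  assumes p: "p \<in> {1..Suc n}" and w: "w permutes {1..n}"
  shows "ins_perm p w permutes {1..Suc n}"
proof (rule bij_imp_permutes)
  have w_in: "w k \<in> {1..n} \<longleftrightarrow> k \<in> {1..n}" for k
    by (rule permutes_in_image[OF w])
  have w_inj: "w a = w b \<longleftrightarrow> a = b" for a b
    using permutes_inj[OF w] by (auto simp: inj_def)
  have skip_in: "ins_perm p w i \<in> {2..Suc n}" if "i \<in> {1..Suc n}" "i \<noteq> p" for i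
    using that p w_in[of "if i < p then i else i - 1"] by (auto simp: ins_perm_skip)
  have "inj_on (ins_perm p w) {1..Suc n}"
  proof (rule inj_onI)
    fix i j assume ij: "i \<in> {1..Suc n}" "j \<in> {1..Suc n}" "ins_perm p w i = ins_perm p w j"
    consider "i = p" | "j = p" | "i \<noteq> p" "j \<noteq> p" by blast
    then show "i = j"
    proof cases
      case 1
      then show ?thesis using ij skip_in[of j] ins_perm_at[of p w] p by auto
    next
      case 2
      then show ?thesis using ij skip_in[of i] ins_perm_at[of p w] p by auto
    next
      case 3
      then show ?thesis using ij p by (auto simp: ins_perm_skip w_inj split: if_splits)
    qed
  qed
  moreover have "ins_perm p w ` {1..Suc n} \<subseteq> {1..Suc n}"
  proof (rule image_subsetI)
    fix i assume "i \<in> {1..Suc n}"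
    then show "ins_perm p w i \<in> {1..Suc n}"
      using skip_in[of i] ins_perm_at[of p w] p by (cases "i = p") auto
  qed
  ultimately show "bij_betw (ins_perm p w) {1..Suc n} {1..Suc n}"
    by (simp add: bij_betw_def endo_inj_surj)
  show "ins_perm p w i = i" if "i \<notin> {1..Suc n}" for i
  proof (cases "i = 0")
    case False
    with that have "w (i - 1) = i - 1" by (intro permutes_not_in[OF w]) auto
    with that False p show ?thesis by (auto simp: ins_perm_def ins_at_def)
  qed (simp add: ins_perm_def)
qed

text \<open>Injectivity: \<open>p\<close> is recovered as the place of the value 1. Surjectivity:
  both sides have \<open>fact (Suc n)\<close> elements.\<close>

lemma bij_betw_ins_perm:
  "bij_betw (\<lambda>(p, w). ins_perm p w) ({1..Suc n} \<times> {w. w permutes {1..n}}) {w. w permutes {1..Suc n}}"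
proof -
  let ?A = "{1..Suc n} \<times> {w. w permutes {1..n}}"
  let ?f = "\<lambda>(p, w). ins_perm p w"
  have inj: "inj_on ?f ?A"
  proof (rule inj_onI, clarify, intro conjI)
    fix p w q u
    assume p: "p \<in> {1..Suc n}" and q: "q \<in> {1..Suc n}" and w: "w permutes {1..n}" and u: "u permutes {1..n}"
      and eq: "ins_perm p w = ins_perm q u"
    have "inj (ins_perm p w)" using ins_perm_permutes[OF p w] by (rule permutes_inj)
    moreover have "ins_perm p w q = ins_perm p w p"
      using ins_perm_at[of p w] ins_perm_at[of q u] p q by (simp add: eq)
    ultimately show pq: "p = q" by (simp add: inj_def)
    show "w = u"
    proof
      fix k
      show "w k = u k"
      proof (cases "k \<in> {1..n}")
        case True
        show ?thesis
        proof (cases "k < p")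
          case True
          with \<open>k \<in> {1..n}\<close> fun_cong[OF eq, of k] pq show ?thesis by (simp add: ins_perm_skip)
        next
          case False
          with \<open>k \<in> {1..n}\<close> fun_cong[OF eq, of "Suc k"] pq show ?thesis by (simp add: ins_perm_skip)
        qed
      next
        case False
        then show ?thesis using w u by (simp add: permutes_not_in)
      qed
    qed
  qed
  moreover have "?f ` ?A = {w. w permutes {1..Suc n}}"
  proof (rule card_subset_eq)
    show "finite {w. w permutes {1..Suc n}}" by (simp add: finite_permutations)
    show "?f ` ?A \<subseteq> {w. w permutes {1..Suc n}}" using ins_perm_permutes by auto
    show "card (?f ` ?A) = card {w. w permutes {1..Suc n}}"
      using inj by (simp add: card_image card_cartesian_product card_permutations)
  qed
  ultimately show ?thesis by (simp add: bij_betw_def)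
qed

lemma HL_R_Suc_insert:
  "HL_R (Suc n) lam z t
     = (\<Sum>w | w permutes {1..n}. insert_sum lam (z 1) t (Suc n) (z \<circ> Suc \<circ> w) * HL_cross n t (z \<circ> Suc \<circ> w))"
proof -
  have "HL_R (Suc n) lam z t = (\<Sum>(p, w)\<in>{1..Suc n} \<times> {w. w permutes {1..n}}.
      HL_summand (Suc n) lam (z \<circ> ins_perm p w) t)"
    unfolding HL_R_def
    by (subst sum.reindex_bij_betw[OF bij_betw_ins_perm, symmetric]) (simp add: case_prod_unfold)
  also have "\<dots> = (\<Sum>(p, w)\<in>{1..Suc n} \<times> {w. w permutes {1..n}}.
      HL_summand (Suc n) lam (ins_at p (z 1) (z \<circ> Suc \<circ> w)) t)"
    by (intro sum.cong refl) (auto intro!: HL_summand_cong simp: ins_perm_def ins_at_def)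
  also have "\<dots> = (\<Sum>w | w permutes {1..n}. \<Sum>p\<in>{1..Suc n}.
      HL_summand (Suc n) lam (ins_at p (z 1) (z \<circ> Suc \<circ> w)) t)"
    by (subst sum.swap) (simp add: sum.cartesian_product)
  finally show ?thesis by (simp only: sum_HL_summand_ins_at)
qed

subsection \<open>The kernel of the symmetrization\<close>

definition swap_inv :: "nat \<Rightarrow> ((nat \<Rightarrow> 'a) \<Rightarrow> 'b) \<Rightarrow> bool" where
  "swap_inv k f \<longleftrightarrow> (\<forall>y. f (y \<circ> transpose k (Suc k)) = f y)"

text \<open>Adjacent transpositions generate the symmetric group, so this is symmetry in
  \<open>y 1, ..., y L\<close>, checked one swap at a time.\<close>

definition sym_below :: "nat \<Rightarrow> ((nat \<Rightarrow> 'a) \<Rightarrow> 'b) \<Rightarrow> bool" where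
  "sym_below L f \<longleftrightarrow> (\<forall>k\<in>{1..<L}. swap_inv k f)"

text \<open>
  The multiplier \<open>h\<close> makes the condition stable under adding parts and columns.  The case \<open>n < L\<close> is
  left unconstrained: the top partition has \<open>n + 1\<close> parts, but there are only \<open>n\<close> variables \<open>y\<close>.
\<close>
definition symm_null :: "nat \<Rightarrow> (nat \<Rightarrow> 'a::field) \<Rightarrow> 'a \<Rightarrow> nat \<Rightarrow> ((nat \<Rightarrow> 'a) \<Rightarrow> 'a) \<Rightarrow> bool" where
  "symm_null n y0 t L f \<longleftrightarrow> (L \<le> n \<longrightarrow> (\<forall>h. sym_below L h \<longrightarrow>
     (\<Sum>w | w permutes {1..n}. h (y0 \<circ> w) * f (y0 \<circ> w) * HL_cross n t (y0 \<circ> w)) = 0))"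

lemma symm_nullI:
  assumes "\<And>h. L \<le> n \<Longrightarrow> sym_below L h \<Longrightarrow>
     (\<Sum>w | w permutes {1..n}. h (y0 \<circ> w) * f (y0 \<circ> w) * HL_cross n t (y0 \<circ> w)) = 0"
  shows "symm_null n y0 t L f"
  using assms by (simp add: symm_null_def)

lemma symm_nullD:
  assumes "symm_null n y0 t L f" "L \<le> n" "sym_below L h"
  shows "(\<Sum>w | w permutes {1..n}. h (y0 \<circ> w) * f (y0 \<circ> w) * HL_cross n t (y0 \<circ> w)) = 0"
  using assms by (simp add: symm_null_def)

lemma symm_null_cong:
  assumes "symm_null n y0 t L f" "\<And>w. L \<le> n \<Longrightarrow> w permutes {1..n} \<Longrightarrow> f (y0 \<circ> w) = g (y0 \<circ> w)"
  shows "symm_null n y0 t L g"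
proof (rule symm_nullI)
  fix h :: "(nat \<Rightarrow> 'a) \<Rightarrow> 'a" assume L: "L \<le> n" and h: "sym_below L h"
  have "(\<Sum>w | w permutes {1..n}. h (y0 \<circ> w) * g (y0 \<circ> w) * HL_cross n t (y0 \<circ> w))
      = (\<Sum>w | w permutes {1..n}. h (y0 \<circ> w) * f (y0 \<circ> w) * HL_cross n t (y0 \<circ> w))"
    by (intro sum.cong) (auto simp: assms(2)[OF L])
  then show "(\<Sum>w | w permutes {1..n}. h (y0 \<circ> w) * g (y0 \<circ> w) * HL_cross n t (y0 \<circ> w)) = 0"
    using symm_nullD[OF assms(1) L h] by simp
qed

lemma symm_null_zero: "symm_null n y0 t L (\<lambda>y. 0)"
  by (rule symm_nullI) simp

lemma symm_null_add:
  assumes "symm_null n y0 t L f" "symm_null n y0 t L g"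
  shows "symm_null n y0 t L (\<lambda>y. f y + g y)"
  using assms by (simp add: symm_null_def ring_distribs sum.distrib)

lemma symm_null_mult:
  assumes "symm_null n y0 t L f" "sym_below L u"
  shows "symm_null n y0 t L (\<lambda>y. u y * f y)"
proof (rule symm_nullI)
  fix h :: "(nat \<Rightarrow> 'a) \<Rightarrow> 'a" assume L: "L \<le> n" and "sym_below L h"
  then have "sym_below L (\<lambda>y. h y * u y)"
    using assms(2) by (simp add: sym_below_def swap_inv_def)
  from symm_nullD[OF assms(1) L this]
  show "(\<Sum>w | w permutes {1..n}. h (y0 \<circ> w) * (u (y0 \<circ> w) * f (y0 \<circ> w)) * HL_cross n t (y0 \<circ> w)) = 0"
    by (simp add: mult.assoc)
qed

lemma symm_null_mono:
  "symm_null n y0 t L f \<Longrightarrow> L \<le> L' \<Longrightarrow> symm_null n y0 t L' f"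
  by (auto simp: symm_null_def sym_below_def)

lemma sym_below_const: "sym_below L (\<lambda>y. c)"
  by (simp add: sym_below_def swap_inv_def)

lemma sym_below_prod: "sym_below L (\<lambda>y. \<Prod>i\<in>{1..L}. y i :: 'a::comm_monoid_mult)"
  unfolding sym_below_def swap_inv_def
proof (intro ballI allI)
  fix k and y :: "nat \<Rightarrow> 'a" assume "k \<in> {1..<L}"
  then have "transpose k (Suc k) permutes {1..L}" by (intro permutes_swap_id) auto
  then show "(\<Prod>i\<in>{1..L}. (y \<circ> transpose k (Suc k)) i) = (\<Prod>i\<in>{1..L}. y i)"
    by (subst prod.permute[of "transpose k (Suc k)" _ y]) (auto simp: o_def)
qed

lemma swap_inv_cong_below:
  assumes "\<And>y y'. (\<And>i. i < k \<Longrightarrow> y i = y' i) \<Longrightarrow> f y = f y'"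
  shows "swap_inv k f"
  unfolding swap_inv_def by (intro allI assms) (auto simp: transpose_def)

text \<open>An adjacent transposition permutes the pairs \<open>i < j\<close> other than
  \<open>(k, Suc k)\<close> among themselves, so only one cross factor changes.\<close>

lemma HL_cross_transpose:
  fixes t :: "'a::field"
  assumes k: "k \<in> {1..<n}"
  defines "s \<equiv> transpose k (Suc k)"
  shows "\<exists>G. (\<forall>y. HL_cross n t y = (y k - t * y (Suc k)) / (y k - y (Suc k)) * G y) \<and> swap_inv k G"
proof (intro exI conjI allI)
  define P where "P = (SIGMA i:{1..n}. {i<..n})"
  let ?q = "\<lambda>y (i, j). (y i - t * y j) / (y i - y j)"
  define G where "G y = prod (?q y) (P - {(k, Suc k)})" for y :: "nat \<Rightarrow> 'a"
  have fin: "finite P" and mem: "(k, Suc k) \<in> P" using k by (auto simp: P_def)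
  have "HL_cross n t y = prod (?q y) P" for y
    unfolding HL_cross_def P_def by (subst prod.Sigma) auto
  then show "HL_cross n t y = (y k - t * y (Suc k)) / (y k - y (Suc k)) * G y" for y
    unfolding G_def using prod.remove[OF fin mem, of "?q y"] by simp
  show "swap_inv k G"
    unfolding swap_inv_def
  proof
    fix y :: "nat \<Rightarrow> 'a"
    have maps: "(s i, s j) \<in> P - {(k, Suc k)}" if "(i, j) \<in> P - {(k, Suc k)}" for i j
      using that k by (auto simp: P_def s_def transpose_def)
    show "G (y \<circ> transpose k (Suc k)) = G y"
      unfolding G_def
    proof (rule prod.reindex_bij_witness[where i = "map_prod s s" and j = "map_prod s s"])
      fix a assume a: "a \<in> P - {(k, Suc k)}"
      show "map_prod s s (map_prod s s a) = a" by (cases a) (simp add: s_def)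
      show "map_prod s s a \<in> P - {(k, Suc k)}" using maps a by (cases a) auto
      show "map_prod s s (map_prod s s a) = a" by (cases a) (simp add: s_def)
      show "map_prod s s a \<in> P - {(k, Suc k)}" using maps a by (cases a) auto
      show "?q y (map_prod s s a) = ?q (y \<circ> transpose k (Suc k)) a" by (cases a) (simp add: s_def)
    qed
  qed
qed

text \<open>Pairing the permutations rather than deriving \<open>2 S = 0\<close> also covers characteristic 2.\<close>
lemma sum_permutes_antisym:
  fixes F :: "(nat \<Rightarrow> nat) \<Rightarrow> 'a::comm_ring_1"
  assumes k: "k \<in> {1..<n}"
    and F: "\<And>w. w permutes {1..n} \<Longrightarrow> F (w \<circ> transpose k (Suc k)) = - F w"
  shows "(\<Sum>w | w permutes {1..n}. F w) = 0"
proof -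
  let ?s = "transpose k (Suc k)"
  let ?A = "{w. w permutes {1..n} \<and> w k < w (Suc k)}" and ?B = "{w. w permutes {1..n} \<and> w (Suc k) < w k}"
  have s: "?s permutes {1..n}" using k by (intro permutes_swap_id) auto
  have fin: "finite {w. w permutes {1..n}}" by (simp add: finite_permutations)
  have neq: "\<not> w permutes {1..n} \<or> w k \<noteq> w (Suc k)" for w
    using permutes_inj[of w "{1..n}"] inj_eq[of w k "Suc k"] by auto
  have "{w. w permutes {1..n}} = ?A \<union> ?B"
  proof (rule set_eqI)
    fix w
    show "w \<in> {w. w permutes {1..n}} \<longleftrightarrow> w \<in> ?A \<union> ?B"
      using neq[of w] by (cases "w k" "w (Suc k)" rule: linorder_cases) simp_all
  qed
  moreover have "finite ?A" by (rule finite_subset[OF _ fin]) blast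
  moreover have "finite ?B" by (rule finite_subset[OF _ fin]) blast
  moreover have "?A \<inter> ?B = {}" by auto
  ultimately have "(\<Sum>w | w permutes {1..n}. F w) = sum F ?A + sum F ?B"
    by (simp only: sum.union_disjoint)
  also have "sum F ?B = (\<Sum>w\<in>?A. - F w)"
  proof (rule sum.reindex_bij_witness[where i = "\<lambda>w. w \<circ> ?s" and j = "\<lambda>w. w \<circ> ?s"])
    show "(w \<circ> ?s) \<circ> ?s = w" for w :: "nat \<Rightarrow> nat" by (simp add: fun_eq_iff)
    show "(w \<circ> ?s) \<circ> ?s = w" for w :: "nat \<Rightarrow> nat" by (simp add: fun_eq_iff)
  qed (use permutes_compose[OF s] F in auto)
  finally show ?thesis by (simp add: sum_negf)
qed

text \<open>Together with the one cross factor that changes, the numerator is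
  \<open>(y (Suc k) - t * y k) * (y k - t * y (Suc k))\<close>, symmetric in the two variables, over
  the antisymmetric \<open>y k - y (Suc k)\<close>. All else is invariant, so the summands cancel in
  pairs.\<close>

lemma symm_null_swap:
  assumes k: "1 \<le> k" and g: "swap_inv k g"
  shows "symm_null n y0 t (Suc k) (\<lambda>y. (y (Suc k) - t * y k) * g y)"
proof (rule symm_nullI)
  fix h :: "(nat \<Rightarrow> 'a) \<Rightarrow> 'a" assume L: "Suc k \<le> n" and "sym_below (Suc k) h"
  then have h: "swap_inv k h" using k by (simp add: sym_below_def)
  have kn: "k \<in> {1..<n}" using k L by simp
  obtain G where G: "\<And>y. HL_cross n t y = (y k - t * y (Suc k)) / (y k - y (Suc k)) * G y" "swap_inv k G"
    using HL_cross_transpose[OF kn, of t] by blast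
  define F where "F y = h y * ((y (Suc k) - t * y k) * g y) * HL_cross n t y" for y
  \<comment> \<open>For \<open>a = b\<close> both sides are 0, since division by 0 gives 0.\<close>
  have neg: "(a - t * b) * (b - t * a) / (b - a) = - ((b - t * a) * (a - t * b) / (a - b))" for a b
  proof -
    have "b - a = - (a - b)" by simp
    then show ?thesis by (simp only: divide_minus_right mult.commute)
  qed
  have "F (y \<circ> transpose k (Suc k)) = - F y" for y
  proof -
    define c where "c y = h y * g y * G y" for y
    define q where "q y = (y (Suc k) - t * y k) * (y k - t * y (Suc k)) / (y k - y (Suc k))" for y
    have F: "F y = c y * q y" for y unfolding F_def G(1) c_def q_def by simp
    have "c (y \<circ> transpose k (Suc k)) = c y" using h g G(2) by (simp add: swap_inv_def c_def)
    moreover have "q (y \<circ> transpose k (Suc k)) = - q y"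
      unfolding q_def by (subst neg[symmetric]) simp
    ultimately show ?thesis by (simp add: F)
  qed
  then have "(\<Sum>w | w permutes {1..n}. F (y0 \<circ> w)) = 0"
    by (intro sum_permutes_antisym[OF kn]) (simp add: o_assoc)
  then show "(\<Sum>w | w permutes {1..n}. h (y0 \<circ> w) * ((\<lambda>y. (y (Suc k) - t * y k) * g y) (y0 \<circ> w))
      * HL_cross n t (y0 \<circ> w)) = 0"
    by (simp only: F_def)
qed

subsection \<open>Closed forms of the partial sums\<close>

text \<open>
  The partial sum with spin \<open>+\<close>.  With \<open>L\<close> parts processed, \<open>before_part\<close> is the contribution of all
  positions of the \<open>L\<close>-th particle, and the second term removes those beyond the current column.
\<close>
definition pending :: "(nat \<Rightarrow> nat) \<Rightarrow> 'a::field \<Rightarrow> 'a \<Rightarrow> nat \<Rightarrow> (nat \<Rightarrow> 'a) \<Rightarrow> 'a" where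
  "pending rho x t L y = before_part rho x t L y - (1 - t) * insert_sum rho x t L y * (x / (y L - x))"

lemma before_part_cong:
  "(\<And>k. k \<in> {1..L} \<Longrightarrow> y k = y' k) \<Longrightarrow> before_part rho x t L y = before_part rho x t L y'"
  unfolding before_part_def by (intro prod.cong) auto

text \<open>With \<open>x\<close> among them, \<open>L\<close> positions hold only
  \<open>L - 1\<close> of the other variables, so \<open>y L\<close> does not occur. Hence
  exchanging \<open>y L\<close> and \<open>y (Suc L)\<close> has no effect.\<close>

lemma insert_sum_cong:
  "(\<And>k. k < L \<Longrightarrow> y k = y' k) \<Longrightarrow> insert_sum rho x t L y = insert_sum rho x t L y'"
proof (induction L)
  case (Suc L)
  moreover have "before_part rho x t L y = before_part rho x t L y'"
    using Suc.prems by (intro before_part_cong) auto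
  ultimately show ?case by simp
qed simp

lemma before_part_shift:
  assumes "\<And>k. k \<in> {1..L} \<Longrightarrow> rho' k = Suc (rho k)"
  shows "before_part rho' x t L y = (\<Prod>i\<in>{1..L}. y i) * before_part rho x t L y"
  unfolding before_part_def prod.distrib[symmetric]
  by (intro prod.cong refl) (simp add: assms)

text \<open>Raising all \<open>L\<close> parts by one multiplies each monomial by the variables
  present, which are \<open>x\<close> and \<open>y 1, ..., y (L - 1)\<close>.\<close>

lemma insert_sum_shift:
  assumes "\<And>k. k \<in> {1..L} \<Longrightarrow> rho' k = Suc (rho k)"
  shows "insert_sum rho' x t L y = x * (\<Prod>i\<in>{1..L - 1}. y i) * insert_sum rho x t L y"
  using assms
proof (induction L)
  case (Suc L)
  have r: "rho' (Suc L) = Suc (rho (Suc L))" using Suc.prems by simp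
  have "before_part rho' x t L y = (\<Prod>i\<in>{1..L}. y i) * before_part rho x t L y"
    using Suc.prems by (intro before_part_shift) auto
  moreover have "insert_sum rho' x t L y * y L = x * (\<Prod>i\<in>{1..L}. y i) * insert_sum rho x t L y"
  proof (cases L)
    case L: (Suc L')
    then have "(\<Prod>i\<in>{1..L}. y i) = (\<Prod>i\<in>{1..L - 1}. y i) * y L"
      by simp
    moreover have "insert_sum rho' x t L y = x * (\<Prod>i\<in>{1..L - 1}. y i) * insert_sum rho x t L y"
      using Suc.IH Suc.prems by auto
    ultimately show ?thesis by (simp only: ac_simps)
  qed simp
  moreover have "insert_sum rho' x t (Suc L) y = x * x ^ rho (Suc L) * before_part rho' x t L y
     + insert_sum rho' x t L y * y L * (y L ^ rho (Suc L) * ((x - t * y L) / (x - y L)))"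
    by (simp only: insert_sum.simps r power_Suc mult.assoc)
  ultimately have "insert_sum rho' x t (Suc L) y
     = x * x ^ rho (Suc L) * ((\<Prod>i\<in>{1..L}. y i) * before_part rho x t L y)
     + x * (\<Prod>i\<in>{1..L}. y i) * insert_sum rho x t L y * (y L ^ rho (Suc L) * ((x - t * y L) / (x - y L)))"
    by simp
  then show ?case
    by (simp only: insert_sum.simps diff_Suc_1 distrib_left) (simp only: ac_simps)
qed simp

text \<open>The two terms of \<open>pending\<close> scale differently, by \<open>y L\<close> against
  \<open>x\<close>. The discrepancy is a multiple of \<open>y L - x\<close>, which cancels the
  denominator and leaves \<open>x * (1 - t)\<close>, the weight of a path that comes from the left
  and turns down.\<close>

lemma pending_shift:
  assumes "\<And>k. k \<in> {1..L} \<Longrightarrow> rho' k = Suc (rho k)" and nz: "1 \<le> L \<Longrightarrow> y L \<noteq> x"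
  shows "pending rho' x t L y = (\<Prod>i\<in>{1..L}. y i) * pending rho x t L y
     + x * (1 - t) * ((\<Prod>i\<in>{1..L - 1}. y i) * insert_sum rho x t L y)"
proof (cases L)
  case (Suc L')
  then have prod: "(\<Prod>i\<in>{1..L}. y i) = (\<Prod>i\<in>{1..L - 1}. y i) * y L" by simp
  have eq: "E * v * B - (1 - t) * (x * E * I) * (x / (v - x))
     = E * v * (B - (1 - t) * I * (x / (v - x))) + x * (1 - t) * (E * I)" if "v - x \<noteq> 0" for B E I v
    using that by (simp add: divide_simps) (simp add: algebra_simps)
  have "before_part rho' x t L y = (\<Prod>i\<in>{1..L}. y i) * before_part rho x t L y"
    "insert_sum rho' x t L y = x * (\<Prod>i\<in>{1..L - 1}. y i) * insert_sum rho x t L y"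
    by (intro before_part_shift insert_sum_shift assms(1); assumption)+
  then show ?thesis
    unfolding pending_def prod using nz Suc eq[of "y L"] by (simp only:) simp
next
  case 0
  then show ?thesis by (simp add: pending_def before_part_def)
qed

text \<open>The new part is 0, so its powers are 1, and
  \<open>t - (1 - t) * x / (y L - x) = (x - t * y L) / (x - y L)\<close>.\<close>

lemma insert_sum_add_part:
  assumes "rho (Suc L) = 0" and nz: "1 \<le> L \<Longrightarrow> y L \<noteq> x"
  shows "t * insert_sum rho x t L y + pending rho x t L y = insert_sum rho x t (Suc L) y"
proof (cases L)
  case (Suc L')
  then have "y L - x \<noteq> 0" "x - y L \<noteq> 0" using nz by auto
  then have "t * I + (B - (1 - t) * I * (x / (y L - x))) = B + I * ((x - t * y L) / (x - y L))" for B I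
    by (simp add: divide_simps) (simp add: algebra_simps)
  then show ?thesis
    unfolding pending_def insert_sum.simps(2) assms(1) by simp
next
  case 0
  then show ?thesis using assms by (simp add: pending_def before_part_def)
qed

text \<open>
  The numerator \<open>y (Suc L) - t * y L\<close> of the difference cancels against the cross factors of the
  variables \<open>L\<close> and \<open>Suc L\<close> after symmetrization.
\<close>
lemma pending_add_part:
  assumes "rho (Suc L) = 0" "y (Suc L) \<noteq> x" "1 \<le> L \<Longrightarrow> y L \<noteq> x"
  shows "pending rho x t L y - pending rho x t (Suc L) y
    = (y (Suc L) - t * y L) * (- (1 - t) * x * insert_sum rho x t L y / ((y L - x) * (y (Suc L) - x)))"
proof (cases L)
  case (Suc L')
  define B I u v where "B = before_part rho x t L y" and "I = insert_sum rho x t L y"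
    and "u = y L" and "v = y (Suc L)"
  have nz: "u - x \<noteq> 0" "v - x \<noteq> 0" "x - u \<noteq> 0" using assms Suc by (auto simp: u_def v_def)
  have 1: "pending rho x t L y = B - (1 - t) * I * (x / (u - x))"
    by (simp add: pending_def B_def I_def u_def)
  have 2: "pending rho x t (Suc L) y
      = B * ((v - t * x) / (v - x)) - (1 - t) * (B + I * ((x - t * u) / (x - u))) * (x / (v - x))"
    using assms(1) by (simp add: pending_def before_part_def B_def I_def u_def v_def)
  have "pending rho x t L y - pending rho x t (Suc L) y = (v - t * u) * (- (1 - t) * x * I / ((u - x) * (v - x)))"
    unfolding 1 2 using nz by (simp add: divide_simps) (simp add: algebra_simps)
  then show ?thesis by (simp add: I_def u_def v_def)
next
  case 0
  have "(y (Suc 0) - x) \<noteq> 0" using assms 0 by simp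
  then show ?thesis using assms(1) 0
    by (simp add: pending_def before_part_def divide_simps) (simp add: algebra_simps)
qed

text \<open>
  \<open>Sm\<close> and \<open>Sp\<close> are the partial sums with spins \<open>-\<close> and \<open>+\<close> on the current horizontal edge, after \<open>L\<close>
  parts of the top partition; \<open>rho\<close> lists these parts minus the number of the current column.
\<close>
definition column_inv ::
    "nat \<Rightarrow> (nat \<Rightarrow> 'a::field) \<Rightarrow> 'a \<Rightarrow> 'a \<Rightarrow> (nat \<Rightarrow> nat) \<Rightarrow> nat
      \<Rightarrow> ((nat \<Rightarrow> 'a) \<Rightarrow> 'a) \<Rightarrow> ((nat \<Rightarrow> 'a) \<Rightarrow> 'a) \<Rightarrow> bool" where
  "column_inv n y0 x t rho L Sm Sp \<longleftrightarrow>
     symm_null n y0 t (L - 1) (\<lambda>y. Sm y - insert_sum rho x t L y) \<and>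
     symm_null n y0 t L (\<lambda>y. Sp y - pending rho x t L y)"

lemma perm_neq:
  "\<forall>k\<in>{1..n}. y0 k \<noteq> x \<Longrightarrow> w permutes {1..n} \<Longrightarrow> k \<in> {1..n} \<Longrightarrow> (y0 \<circ> w) k \<noteq> x"
  using permutes_in_image[of w "{1..n}" k] by auto

text \<open>The next column raises every part by one, and by the shift lemmas the closed forms obey
  the recursion of the partial sums. The errors are only multiplied by symmetric functions, so they
  stay in the kernel. With spin \<open>-\<close> one particle is still travelling, hence the
  \<open>L - 1\<close> variables.\<close>

lemma column_inv_next:
  assumes neq: "\<forall>k\<in>{1..n}. y0 k \<noteq> x" and inv: "column_inv n y0 x t rho L Sm Sp" and rho': "\<And>k. k \<in> {1..L} \<Longrightarrow> rho' k = Suc (rho k)"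
  shows "column_inv n y0 x t rho' L (\<lambda>y. x * (\<Prod>i\<in>{1..L - 1}. y i) * Sm y)
     (\<lambda>y. (\<Prod>i\<in>{1..L}. y i) * Sp y + x * (1 - t) * ((\<Prod>i\<in>{1..L - 1}. y i) * Sm y))"
  unfolding column_inv_def
proof
  from inv have m: "symm_null n y0 t (L - 1) (\<lambda>y. Sm y - insert_sum rho x t L y)"
    and p: "symm_null n y0 t L (\<lambda>y. Sp y - pending rho x t L y)" by (auto simp: column_inv_def)
  have m': "symm_null n y0 t (L - 1) (\<lambda>y. (\<Prod>i\<in>{1..L - 1}. y i) * (Sm y - insert_sum rho x t L y))"
    by (rule symm_null_mult[OF m sym_below_prod])
  show "symm_null n y0 t (L - 1) (\<lambda>y. x * (\<Prod>i\<in>{1..L - 1}. y i) * Sm y - insert_sum rho' x t L y)"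
    by (rule symm_null_cong[OF symm_null_mult[OF m' sym_below_const[of _ x]]])
       (simp only: insert_sum_shift[of L rho' rho x t, OF rho'] right_diff_distrib mult.assoc)
  have "symm_null n y0 t L (\<lambda>y. (\<Prod>i\<in>{1..L}. y i) * (Sp y - pending rho x t L y)
      + x * (1 - t) * ((\<Prod>i\<in>{1..L - 1}. y i) * (Sm y - insert_sum rho x t L y)))"
    by (intro symm_null_add symm_null_mult[OF p sym_below_prod] symm_null_mult[OF _ sym_below_const]
        symm_null_mono[OF m']) auto
  then show "symm_null n y0 t L (\<lambda>y. (\<Prod>i\<in>{1..L}. y i) * Sp y + x * (1 - t) * ((\<Prod>i\<in>{1..L - 1}. y i) * Sm y)
      - pending rho' x t L y)"
  proof (rule symm_null_cong)
    fix w assume "L \<le> n" "w permutes {1..n}"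
    then have nz: "1 \<le> L \<Longrightarrow> (y0 \<circ> w) L \<noteq> x" by (intro perm_neq[OF neq]) auto
    show "(\<Prod>i\<in>{1..L}. (y0 \<circ> w) i) * (Sp (y0 \<circ> w) - pending rho x t L (y0 \<circ> w))
      + x * (1 - t) * ((\<Prod>i\<in>{1..L - 1}. (y0 \<circ> w) i) * (Sm (y0 \<circ> w) - insert_sum rho x t L (y0 \<circ> w)))
      = (\<Prod>i\<in>{1..L}. (y0 \<circ> w) i) * Sp (y0 \<circ> w) + x * (1 - t) * ((\<Prod>i\<in>{1..L - 1}. (y0 \<circ> w) i) * Sm (y0 \<circ> w))
      - pending rho' x t L (y0 \<circ> w)"
      using pending_shift[of L rho' rho "y0 \<circ> w" x t, OF rho' nz]
      by (simp add: algebra_simps)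
  qed
qed

text \<open>Spin \<open>-\<close> is \<open>insert_sum_add_part\<close>; its new level
  \<open>L\<close> is that of the old error of \<open>Sp\<close>. For spin \<open>+\<close> the
  partial sum stays, and the closed form changes by the kernel element of
  \<open>pending_add_part\<close>.\<close>

lemma column_inv_add_part:
  assumes neq: "\<forall>k\<in>{1..n}. y0 k \<noteq> x" and inv: "column_inv n y0 x t rho L Sm Sp" and rho: "rho (Suc L) = 0"
  shows "column_inv n y0 x t rho (Suc L) (\<lambda>y. t * Sm y + Sp y) Sp"
  unfolding column_inv_def
proof
  from inv have m: "symm_null n y0 t (L - 1) (\<lambda>y. Sm y - insert_sum rho x t L y)"
    and p: "symm_null n y0 t L (\<lambda>y. Sp y - pending rho x t L y)" by (auto simp: column_inv_def)
  have nz: "(y0 \<circ> w) k \<noteq> x" if "k \<le> n" "w permutes {1..n}" "1 \<le> k" for w k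
    using that by (intro perm_neq[OF neq]) auto
  have "symm_null n y0 t L (\<lambda>y. t * (Sm y - insert_sum rho x t L y) + (Sp y - pending rho x t L y))"
    by (intro symm_null_add symm_null_mult[OF _ sym_below_const] symm_null_mono[OF m] p) auto
  then show "symm_null n y0 t (Suc L - 1) (\<lambda>y. t * Sm y + Sp y - insert_sum rho x t (Suc L) y)"
    unfolding diff_Suc_1
  proof (rule symm_null_cong)
    fix w assume "L \<le> n" "w permutes {1..n}"
    then have "t * insert_sum rho x t L (y0 \<circ> w) + pending rho x t L (y0 \<circ> w) = insert_sum rho x t (Suc L) (y0 \<circ> w)"
      by (intro insert_sum_add_part rho nz)
    then show "t * (Sm (y0 \<circ> w) - insert_sum rho x t L (y0 \<circ> w)) + (Sp (y0 \<circ> w) - pending rho x t L (y0 \<circ> w))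
       = t * Sm (y0 \<circ> w) + Sp (y0 \<circ> w) - insert_sum rho x t (Suc L) (y0 \<circ> w)"
      by (simp add: algebra_simps del: insert_sum.simps)
  qed
  \<comment> \<open>The cofactor in \<open>pending_add_part\<close>, invariant under exchanging
    \<open>y L\<close> and \<open>y (Suc L)\<close> as \<open>symm_null_swap\<close>
    requires.\<close>
  define g where "g y = - (1 - t) * x * insert_sum rho x t L y / ((y L - x) * (y (Suc L) - x))" for y
  have "symm_null n y0 t (Suc L) (\<lambda>y. (y (Suc L) - t * y L) * g y)"
  proof (cases L)
    case 0
    show ?thesis by (rule symm_null_cong[OF symm_null_zero]) (simp add: 0 g_def)
  next
    case (Suc L')
    have "swap_inv L (insert_sum rho x t L)"
      by (rule swap_inv_cong_below) (rule insert_sum_cong)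
    then have "swap_inv L g" by (simp add: swap_inv_def g_def mult.commute)
    with Suc show ?thesis by (intro symm_null_swap) auto
  qed
  then have "symm_null n y0 t (Suc L) (\<lambda>y. (Sp y - pending rho x t L y) + (y (Suc L) - t * y L) * g y)"
    by (intro symm_null_add symm_null_mono[OF p]) auto
  then show "symm_null n y0 t (Suc L) (\<lambda>y. Sp y - pending rho x t (Suc L) y)"
  proof (rule symm_null_cong)
    fix w assume L: "Suc L \<le> n" and w: "w permutes {1..n}"
    have eq: "pending rho x t L (y0 \<circ> w) - pending rho x t (Suc L) (y0 \<circ> w)
       = ((y0 \<circ> w) (Suc L) - t * (y0 \<circ> w) L) * g (y0 \<circ> w)"
      unfolding g_def using L w by (intro pending_add_part rho nz) auto
    show "(Sp (y0 \<circ> w) - pending rho x t L (y0 \<circ> w)) + ((y0 \<circ> w) (Suc L) - t * (y0 \<circ> w) L) * g (y0 \<circ> w)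
       = Sp (y0 \<circ> w) - pending rho x t (Suc L) (y0 \<circ> w)"
      unfolding eq[symmetric] by simp
  qed
qed

subsection \<open>The branching rule\<close>

definition top_count :: "nat \<Rightarrow> (nat \<Rightarrow> nat) \<Rightarrow> nat \<Rightarrow> nat" where
  "top_count N m j = (\<Sum>k\<in>{j..N}. m k)"

text \<open>The partition whose conjugate has the parts \<open>top_count N m 1, \<dots>, top_count N m N\<close>.\<close>
definition part :: "nat \<Rightarrow> (nat \<Rightarrow> nat) \<Rightarrow> nat \<Rightarrow> nat" where
  "part N m k = card {j \<in> {1..N}. k \<le> top_count N m j}"

text \<open>The monomial in which \<open>y i\<close> has the truncated exponent
  \<open>part N m i - j\<close>, written by columns of the Young diagram so that each lattice column
  contributes one factor.\<close>

definition mono_from :: "nat \<Rightarrow> nat \<Rightarrow> (nat \<Rightarrow> nat) \<Rightarrow> (nat \<Rightarrow> 'a::field) \<Rightarrow> 'a" where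
  "mono_from N j m y = (\<Prod>l\<in>{j<..N}. \<Prod>i\<in>{1..top_count N m l}. y i)"

text \<open>
  The leftmost \<open>d\<close> columns \<open>N, \<dots>, N + 1 - d\<close> of a row with top spins \<open>m\<close> and bottom spins \<open>m'\<close>, summed over
  the interior horizontal spins; \<open>b\<close> is the spin of the edge to their right.
\<close>
primrec row_sum :: "nat \<Rightarrow> (nat \<Rightarrow> nat) \<Rightarrow> (nat \<Rightarrow> nat) \<Rightarrow> 'a::field \<Rightarrow> 'a \<Rightarrow> nat \<Rightarrow> hspin \<Rightarrow> 'a" where
  "row_sum N m m' x t 0 b = (if b = Plus then 1 else 0)"
| "row_sum N m m' x t (Suc d) b =
     (\<Sum>a\<in>{Plus, Minus}. R_weight x t a (m (N - d)) b (m' (N - d)) * row_sum N m m' x t d a)"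

text \<open>The cutoff \<open>K\<close> makes the sum finite; no nonzero weight is lost when the top
  spins are below \<open>K\<close>.\<close>

definition config_sum ::
    "nat \<Rightarrow> nat \<Rightarrow> (nat \<Rightarrow> nat) \<Rightarrow> 'a::field \<Rightarrow> 'a \<Rightarrow> nat \<Rightarrow> hspin \<Rightarrow> (nat \<Rightarrow> 'a) \<Rightarrow> 'a" where
  "config_sum N K m x t d b y =
     (\<Sum>m'\<in>{Suc N - d..N} \<rightarrow>\<^sub>E {0..K}. row_sum N m m' x t d b * mono_from N (Suc N - d) m' y)"

section \<open>Particle counts and Young diagrams\<close>

lemma top_count_Suc: "j \<le> N \<Longrightarrow> top_count N m j = m j + top_count N m (Suc j)"
  unfolding top_count_def by (simp add: sum.atLeast_Suc_atMost)

lemma top_count_antimono: "j \<le> l \<Longrightarrow> top_count N m l \<le> top_count N m j"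
  unfolding top_count_def by (intro sum_mono2) auto

lemma top_count_cong: "(\<And>k. k \<in> {j..N} \<Longrightarrow> m k = m' k) \<Longrightarrow> top_count N m j = top_count N m' j"
  unfolding top_count_def by (intro sum.cong) auto

text \<open>As \<open>top_count\<close> decreases in the column, the columns counted by
  \<open>part\<close> form an initial segment. This is the duality of conjugate partitions.\<close>

lemma le_part_iff:
  assumes "1 \<le> j" "j \<le> N"
  shows "j \<le> part N m k \<longleftrightarrow> k \<le> top_count N m j"
proof -
  define S where "S = {j \<in> {1..N}. k \<le> top_count N m j}"
  have fin: "finite S" by (simp add: S_def)
  have down: "l \<in> S" if "l' \<in> S" "1 \<le> l" "l \<le> l'" for l l'
    using that top_count_antimono[of l l' N m] by (auto simp: S_def)
  define p where "p = (if S = {} then 0 else Max S)"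
  have "S = {1..p}"
  proof (cases "S = {}")
    case False
    then have "Max S \<in> S" using fin by simp
    then have "{1..Max S} \<subseteq> S" using down by auto
    moreover have "S \<subseteq> {1..Max S}" using fin by (auto simp: S_def)
    ultimately show ?thesis using False by (simp add: p_def)
  qed (simp add: p_def)
  then have "part N m k = p" unfolding part_def S_def[symmetric] by simp
  moreover have "j \<le> p \<longleftrightarrow> j \<in> S" using \<open>S = {1..p}\<close> assms by simp
  ultimately show ?thesis using assms by (simp add: S_def)
qed

lemma part_le: "part N m k \<le> N"
proof -
  have "card {j \<in> {1..N}. k \<le> top_count N m j} \<le> card {1..N}" by (rule card_mono) auto
  then show ?thesis by (simp add: part_def)
qed

text \<open>Both sides multiply over the cells of the Young diagram, by rows and by columns.\<close>

lemma prod_power_part: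
  assumes "top_count N m 0 \<le> n"
  shows "(\<Prod>i\<in>{1..n}. y i ^ part N m i) = mono_from N 0 m y"
proof -
  have "(\<Prod>i\<in>{1..n}. y i ^ part N m i) = (\<Prod>i\<in>{1..n}. \<Prod>l\<in>{1..N}. if i \<le> top_count N m l then y i else 1)"
    unfolding part_def by (intro prod.cong refl) (simp flip: prod.inter_filter)
  also have "\<dots> = (\<Prod>l\<in>{1..N}. \<Prod>i\<in>{1..n}. if i \<le> top_count N m l then y i else 1)"
    by (rule prod.swap)
  also have "\<dots> = (\<Prod>l\<in>{1..N}. \<Prod>i\<in>{1..top_count N m l}. y i)"
  proof (rule prod.cong[OF refl])
    fix l
    have "top_count N m l \<le> n" using top_count_antimono[of 0 l N m] assms by simp
    then have "{i \<in> {1..n}. i \<le> top_count N m l} = {1..top_count N m l}" by auto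
    then show "(\<Prod>i\<in>{1..n}. if i \<le> top_count N m l then y i else 1) = (\<Prod>i\<in>{1..top_count N m l}. y i)"
      by (simp flip: prod.inter_filter)
  qed
  finally show ?thesis by (simp add: mono_from_def atLeastSucAtMost_greaterThanAtMost)
qed

lemma R_weight_conserves:
  "R_weight x t a n b n' \<noteq> 0 \<Longrightarrow> n + of_bool (a = Minus) = n' + of_bool (b = Minus)"
  by (cases a; cases b) (auto split: if_splits)

text \<open>Every vertex conserves particles if a horizontal \<open>-\<close> counts as one, and the
  left boundary \<open>+\<close> brings in none. A full row ending in \<open>-\<close> thus removes
  one particle.\<close>

lemma row_sum_conserves:
  assumes "d \<le> Suc N" "row_sum N m m' x t d b \<noteq> 0"
  shows "top_count N m (Suc N - d) = top_count N m' (Suc N - d) + of_bool (b = Minus)"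
  using assms
proof (induction d arbitrary: b)
  case 0
  then show ?case by (auto simp: top_count_def split: if_splits)
next
  case (Suc d)
  from Suc.prems(2) obtain a where a: "R_weight x t a (m (N - d)) b (m' (N - d)) \<noteq> 0" "row_sum N m m' x t d a \<noteq> 0"
    unfolding row_sum.simps by (metis (no_types, lifting) mult_eq_0_iff sum.neutral)
  have "top_count N m (Suc (N - d)) = top_count N m' (Suc (N - d)) + of_bool (a = Minus)"
    using Suc.IH[OF _ a(2)] Suc.prems(1) by (simp add: Suc_diff_le)
  with R_weight_conserves[OF a(1)] show ?case
    using Suc.prems(1) by (simp add: top_count_Suc)
qed

lemma row_sum_cong:
  assumes "d \<le> Suc N" "\<And>k. k \<in> {Suc N - d..N} \<Longrightarrow> m' k = m'' k"
  shows "row_sum N m m' x t d b = row_sum N m m'' x t d b"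
  using assms
proof (induction d arbitrary: b)
  case (Suc d)
  have "row_sum N m m' x t d a = row_sum N m m'' x t d a" for a
    using Suc by (intro Suc.IH) auto
  moreover have "m' (N - d) = m'' (N - d)" using Suc.prems by auto
  ultimately show ?case by simp
qed simp

lemma mono_from_upd:
  assumes "j \<le> N"
  shows "mono_from N j (g(j := v)) y = (\<Prod>i\<in>{1..top_count N g (Suc j)}. y i) * mono_from N (Suc j) g y"
proof -
  have "top_count N (g(j := v)) l = top_count N g l" if "j < l" for l
    using that by (intro top_count_cong) auto
  then have "mono_from N j (g(j := v)) y = mono_from N j g y"
    unfolding mono_from_def by (intro prod.cong) auto
  also have "\<dots> = (\<Prod>i\<in>{1..top_count N g (Suc j)}. y i) * mono_from N (Suc j) g y"
  proof (cases "j = N")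
    case True
    then show ?thesis by (simp add: mono_from_def top_count_def)
  next
    case False
    with assms have "{j<..N} = insert (Suc j) {Suc j<..N}" by auto
    then show ?thesis by (simp add: mono_from_def)
  qed
  finally show ?thesis .
qed

lemma sum_PiE_insert:
  assumes "x \<notin> S"
  shows "(\<Sum>f\<in>Pi\<^sub>E (insert x S) T. F f) = (\<Sum>y\<in>T x. \<Sum>g\<in>Pi\<^sub>E S T. F (g(x := y)))"
  unfolding PiE_insert_eq sum.reindex[OF inj_combinator[OF assms]]
  by (simp add: sum.cartesian_product case_prod_unfold)

text \<open>By conservation the bottom count is determined by the top spins and \<open>a\<close>, so
  the new factor of the monomial leaves the sum over bottom spins.\<close>

lemma config_sum_Suc:
  assumes d: "d \<le> N"
  shows "config_sum N K m x t (Suc d) b y =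
    (\<Sum>a\<in>{Plus, Minus}. (\<Sum>v\<in>{0..K}. R_weight x t a (m (N - d)) b v)
       * (\<Prod>i\<in>{1..top_count N m (Suc N - d) - of_bool (a = Minus)}. y i) * config_sum N K m x t d a y)"
proof -
  define j where "j = N - d"
  have j: "Suc N - Suc d = j" "Suc N - d = Suc j" "j \<le> N" "{j..N} = insert j {Suc j..N}"
    using d by (auto simp: j_def)
  have "config_sum N K m x t (Suc d) b y
     = (\<Sum>v\<in>{0..K}. \<Sum>g\<in>{Suc j..N} \<rightarrow>\<^sub>E {0..K}. row_sum N m (g(j := v)) x t (Suc d) b * mono_from N j (g(j := v)) y)"
    unfolding config_sum_def j(1) j(4) by (subst sum_PiE_insert) auto
  also have "\<dots> = (\<Sum>v\<in>{0..K}. \<Sum>g\<in>{Suc j..N} \<rightarrow>\<^sub>E {0..K}. \<Sum>a\<in>{Plus, Minus}.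
      R_weight x t a (m j) b v * ((\<Prod>i\<in>{1..top_count N m (Suc j) - of_bool (a = Minus)}. y i) *
      (row_sum N m g x t d a * mono_from N (Suc j) g y)))"
  proof (intro sum.cong refl)
    fix v g
    have key: "row_sum N m (g(j := v)) x t d a * (\<Prod>i\<in>{1..top_count N g (Suc j)}. y i)
       = row_sum N m g x t d a * (\<Prod>i\<in>{1..top_count N m (Suc j) - of_bool (a = Minus)}. y i)" for a
    proof -
      have "row_sum N m (g(j := v)) x t d a = row_sum N m g x t d a"
        using d by (intro row_sum_cong) (auto simp: j_def)
      moreover have "top_count N g (Suc j) = top_count N m (Suc j) - of_bool (a = Minus)"
        if "row_sum N m g x t d a \<noteq> 0"
        using row_sum_conserves[OF _ that] d j(2) by simp
      ultimately show ?thesis by (cases "row_sum N m g x t d a = 0") auto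
    qed
    have "R * row_sum N m (g(j := v)) x t d a * ((\<Prod>i\<in>{1..top_count N g (Suc j)}. y i) * M)
       = R * ((\<Prod>i\<in>{1..top_count N m (Suc j) - of_bool (a = Minus)}. y i) * (row_sum N m g x t d a * M))"
      for R M a
      using arg_cong[OF key[of a], of "\<lambda>u. R * u * M"] by (simp only: ac_simps)
    then show "row_sum N m (g(j := v)) x t (Suc d) b * mono_from N j (g(j := v)) y =
      (\<Sum>a\<in>{Plus, Minus}.
      R_weight x t a (m j) b v * ((\<Prod>i\<in>{1..top_count N m (Suc j) - of_bool (a = Minus)}. y i) *
      (row_sum N m g x t d a * mono_from N (Suc j) g y)))"
      unfolding mono_from_upd[OF j(3)] row_sum.simps sum_distrib_right
      by (intro sum.cong refl) (simp only: j_def[symmetric] fun_upd_same)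
  qed
  also have "\<dots> = (\<Sum>v\<in>{0..K}. \<Sum>a\<in>{Plus, Minus}. R_weight x t a (m j) b v *
      ((\<Prod>i\<in>{1..top_count N m (Suc j) - of_bool (a = Minus)}. y i) * config_sum N K m x t d a y))"
    unfolding config_sum_def j(2) sum_distrib_left by (subst sum.swap) (rule refl)
  also have "\<dots> = (\<Sum>a\<in>{Plus, Minus}. \<Sum>v\<in>{0..K}. R_weight x t a (m j) b v *
      ((\<Prod>i\<in>{1..top_count N m (Suc j) - of_bool (a = Minus)}. y i) * config_sum N K m x t d a y))"
    by (rule sum.swap)
  finally show ?thesis
    unfolding j(2) j_def[symmetric] sum_distrib_right mult.assoc .
qed

lemma sum_R_weight:
  assumes "n < K"
  shows "(\<Sum>v\<in>{0..K}. R_weight x t Plus n Plus v) = 1"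
    "(\<Sum>v\<in>{0..K}. R_weight x t Minus n Minus v) = x"
    "(\<Sum>v\<in>{0..K}. R_weight x t Minus n Plus v) = x * (1 - t)"
    "(\<Sum>v\<in>{0..K}. R_weight x t Plus n Minus v) = (1 - t ^ n) / (1 - t)"
proof -
  show "(\<Sum>v\<in>{0..K}. R_weight x t Plus n Minus v) = (1 - t ^ n) / (1 - t)"
  proof (cases n)
    case (Suc n')
    have "R_weight x t Plus n Minus v = (if v = n' then (1 - t ^ n) / (1 - t) else 0)" for v
      using Suc by auto
    then show ?thesis using assms Suc by simp
  qed simp
qed (use assms in \<open>simp_all add: sum.delta\<close>)

lemma config_sum_Plus:
  assumes "d \<le> N" "m (N - d) < K"
  shows "config_sum N K m x t (Suc d) Plus y =
    (\<Prod>i\<in>{1..top_count N m (Suc N - d)}. y i) * config_sum N K m x t d Plus y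
    + x * (1 - t) * ((\<Prod>i\<in>{1..top_count N m (Suc N - d) - 1}. y i) * config_sum N K m x t d Minus y)"
  unfolding config_sum_Suc[OF assms(1)] by (simp add: sum_R_weight[OF assms(2)] del: R_weight.simps)

lemma config_sum_Minus:
  assumes "d \<le> N" "m (N - d) < K"
  shows "config_sum N K m x t (Suc d) Minus y =
    x * (\<Prod>i\<in>{1..top_count N m (Suc N - d) - 1}. y i) * config_sum N K m x t d Minus y
    + (1 - t ^ m (N - d)) / (1 - t) * ((\<Prod>i\<in>{1..top_count N m (Suc N - d)}. y i) * config_sum N K m x t d Plus y)"
  unfolding config_sum_Suc[OF assms(1)] by (simp add: sum_R_weight[OF assms(2)] del: R_weight.simps)

text \<open>Induction over columns from the left: \<open>column_inv_next\<close> crosses a column,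
  then \<open>column_inv_add_part\<close> adds its particles.\<close>

lemma config_sum_inv:
  fixes y0 :: "nat \<Rightarrow> 'a::field"
  assumes neq: "\<forall>k\<in>{1..n}. y0 k \<noteq> x" and t: "t \<noteq> 1" and m: "\<And>j. j \<le> N \<Longrightarrow> m j < K"
    and d: "d \<le> Suc N"
  shows "column_inv n y0 x t (\<lambda>k. part N m k - (Suc N - d)) (top_count N m (Suc N - d))
    (config_sum N K m x t d Minus) (config_sum N K m x t d Plus)"
  using d
proof (induction d)
  case 0
  show ?case
    unfolding column_inv_def
    by (auto intro!: symm_null_cong[OF symm_null_zero]
        simp: config_sum_def mono_from_def top_count_def pending_def before_part_def)
next
  case (Suc d)
  define j where "j = N - d"
  have j: "Suc N - Suc d = j" "Suc N - d = Suc j" "j \<le> N" using Suc.prems by (auto simp: j_def)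
  define L where "L = top_count N m (Suc j)"
  define rho where "rho k = part N m k - j" for k
  define Sm where "Sm = config_sum N K m x t d Minus"
  define Sp where "Sp = config_sum N K m x t d Plus"
  define E where "E l y = (\<Prod>i\<in>{1..l}. y i)" for l and y :: "nat \<Rightarrow> 'a"
  define Up where "Up y = E L y * Sp y + x * (1 - t) * (E (L - 1) y * Sm y)" for y
  \<comment> \<open>The spin \<open>-\<close> partial sum if the column had \<open>c\<close>
    particles on top; \<open>Up\<close> does not depend on that number.\<close>
  define Um where "Um c y = x * E (L - 1) y * Sm y + (1 - t ^ c) / (1 - t) * (E L y * Sp y)" for c y
  have IH: "column_inv n y0 x t (\<lambda>k. part N m k - Suc j) L Sm Sp"
    using Suc by (simp add: j(2) L_def Sm_def Sp_def)
  \<comment> \<open>Parts already counted exceed \<open>j\<close>, so they grow by one; all others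
    are at most \<open>j\<close>, and truncated subtraction makes them 0.\<close>
  have rho_old: "rho k = Suc (part N m k - Suc j)" if "k \<in> {1..L}" for k
  proof -
    have "j < N" using that j(3) by (cases "j = N") (auto simp: L_def top_count_def)
    then have "Suc j \<le> part N m k" using that le_part_iff[of "Suc j" N m k] by (simp add: L_def)
    then show ?thesis by (simp add: rho_def)
  qed
  have rho_new: "rho k = 0" if "k > L" for k
  proof (cases "j = N")
    case True
    then show ?thesis using part_le[of N m k] by (simp add: rho_def)
  next
    case False
    then have "\<not> Suc j \<le> part N m k" using that le_part_iff[of "Suc j" N m k] j(3) by (simp add: L_def)
    then show ?thesis by (simp add: rho_def)
  qed
  \<comment> \<open>The weight \<open>(1 - t ^ c) / (1 - t)\<close> of a column with \<open>c\<close> particles satisfies \<open>[c + 1] = t [c] + 1\<close>, so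
    the particles of one column can be added one at a time.\<close>
  have inv: "column_inv n y0 x t rho (L + c) (Um c) Up" for c
  proof (induction c)
    case 0
    show ?case
      using column_inv_next[OF neq IH, of rho] rho_old by (simp add: Um_def Up_def E_def fun_eq_iff)
  next
    case (Suc c)
    have q: "t * ((1 - t ^ c) / (1 - t)) + 1 = (1 - t ^ Suc c) / (1 - t)"
      using t by (simp add: field_simps)
    have "t * Um c y + Up y = Um (Suc c) y" for y
      unfolding Um_def Up_def q[symmetric] by (simp add: algebra_simps)
    then show ?case
      using column_inv_add_part[OF neq Suc.IH rho_new] by simp
  qed
  have dN: "d \<le> N" and mj: "m (N - d) < K" using Suc.prems m[of "N - d"] by auto
  have "Um (m j) = config_sum N K m x t (Suc d) Minus" "Up = config_sum N K m x t (Suc d) Plus"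
    using config_sum_Minus[of d N m K x t, OF dN mj] config_sum_Plus[of d N m K x t, OF dN mj]
    by (simp_all add: fun_eq_iff Um_def Up_def E_def Sm_def Sp_def L_def j_def[symmetric] j(2))
  then show ?case
    using inv[of "m j"] unfolding j(1) top_count_Suc[OF j(3)]
    by (simp add: rho_def[abs_def] L_def add.commute)
qed

text \<open>After column 0 all \<open>Suc n\<close> parts are present, and the spin \<open>-\<close>
  partial sum equals \<open>insert_sum\<close> modulo the kernel at level \<open>n\<close>. The
  multiplier 1 turns this into equality of the symmetrizations.\<close>

lemma HL_R_branching:
  fixes z :: "nat \<Rightarrow> 'a::field"
  assumes z: "\<And>k. k \<in> {2..Suc n} \<Longrightarrow> z k \<noteq> z 1" and t: "t \<noteq> 1" and m: "\<And>j. j \<le> N \<Longrightarrow> m j < K"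
    and count: "top_count N m 0 = Suc n"
  shows "HL_R (Suc n) (part N m) z t
    = (\<Sum>m'\<in>{0..N} \<rightarrow>\<^sub>E {0..K}. row_sum N m m' (z 1) t (Suc N) Minus * HL_R n (part N m') (z \<circ> Suc) t)"
proof -
  define y where "y = z \<circ> Suc"
  have neq: "\<forall>k\<in>{1..n}. y k \<noteq> z 1" using z by (auto simp: y_def)
  have "column_inv n y (z 1) t (\<lambda>k. part N m k - (Suc N - Suc N)) (top_count N m (Suc N - Suc N))
    (config_sum N K m (z 1) t (Suc N) Minus) (config_sum N K m (z 1) t (Suc N) Plus)"
    by (rule config_sum_inv[OF neq t m]) auto
  then have "symm_null n y t n (\<lambda>y. config_sum N K m (z 1) t (Suc N) Minus y
      - insert_sum (part N m) (z 1) t (Suc n) y)"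
    unfolding column_inv_def by (simp add: count del: insert_sum.simps)
  from symm_nullD[OF this order.refl sym_below_const[of _ 1]]
  have "HL_R (Suc n) (part N m) z t
      = (\<Sum>w | w permutes {1..n}. config_sum N K m (z 1) t (Suc N) Minus (y \<circ> w) * HL_cross n t (y \<circ> w))"
    unfolding HL_R_Suc_insert y_def[symmetric] by (simp add: left_diff_distrib sum_subtractf)
  also have "\<dots> = (\<Sum>w | w permutes {1..n}. \<Sum>m'\<in>{0..N} \<rightarrow>\<^sub>E {0..K}.
      row_sum N m m' (z 1) t (Suc N) Minus * (mono_from N 0 m' (y \<circ> w) * HL_cross n t (y \<circ> w)))"
    by (simp add: config_sum_def sum_distrib_right mult.assoc del: row_sum.simps)
  also have "\<dots> = (\<Sum>m'\<in>{0..N} \<rightarrow>\<^sub>E {0..K}. row_sum N m m' (z 1) t (Suc N) Minus *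
      (\<Sum>w | w permutes {1..n}. mono_from N 0 m' (y \<circ> w) * HL_cross n t (y \<circ> w)))"
    unfolding sum_distrib_left by (rule sum.swap)
  also have "\<dots> = (\<Sum>m'\<in>{0..N} \<rightarrow>\<^sub>E {0..K}. row_sum N m m' (z 1) t (Suc N) Minus * HL_R n (part N m') y t)"
  proof (intro sum.cong refl)
    fix m' :: "nat \<Rightarrow> nat"
    show "row_sum N m m' (z 1) t (Suc N) Minus *
      (\<Sum>w | w permutes {1..n}. mono_from N 0 m' (y \<circ> w) * HL_cross n t (y \<circ> w))
      = row_sum N m m' (z 1) t (Suc N) Minus * HL_R n (part N m') y t"
    proof (cases "row_sum N m m' (z 1) t (Suc N) Minus = 0")
      case False
      \<comment> \<open>Since \<open>n\<close> particles remain, \<open>mono_from\<close> is the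
        full monomial of \<open>part N m'\<close>.\<close>
      then have "top_count N m' 0 = n" using row_sum_conserves[OF order.refl False] count by simp
      then show ?thesis by (simp only: HL_R_def HL_summand_cross prod_power_part order.refl)
    qed simp
  qed
  finally show ?thesis by (simp add: y_def)
qed

subsection \<open>The \<open>R\<close>-partition function\<close>

lemma sum_PiE_curry:
  "(\<Sum>f\<in>Pi\<^sub>E (A \<times> B) (\<lambda>(a, b). C a b). F f)
    = (\<Sum>g\<in>Pi\<^sub>E A (\<lambda>a. Pi\<^sub>E B (C a)). F (\<lambda>(a, b)\<in>A \<times> B. g a b))"
proof (rule sum.reindex_bij_witness[where i = "\<lambda>g. \<lambda>(a, b)\<in>A \<times> B. g a b" and j = "\<lambda>f. \<lambda>a\<in>A. \<lambda>b\<in>B. f (a, b)"])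
  fix f assume f: "f \<in> Pi\<^sub>E (A \<times> B) (\<lambda>(a, b). C a b)"
  show "(\<lambda>(a, b)\<in>A \<times> B. (\<lambda>a\<in>A. \<lambda>b\<in>B. f (a, b)) a b) = f"
    using PiE_arb[OF f] by (auto simp: fun_eq_iff restrict_def)
  then show "F (\<lambda>(a, b)\<in>A \<times> B. (\<lambda>a\<in>A. \<lambda>b\<in>B. f (a, b)) a b) = F f" by simp
  show "(\<lambda>a\<in>A. \<lambda>b\<in>B. f (a, b)) \<in> Pi\<^sub>E A (\<lambda>a. Pi\<^sub>E B (C a))"
    using f by (auto simp: PiE_iff)
next
  fix g assume g: "g \<in> Pi\<^sub>E A (\<lambda>a. Pi\<^sub>E B (C a))"
  show "(\<lambda>(a, b)\<in>A \<times> B. g a b) \<in> Pi\<^sub>E (A \<times> B) (\<lambda>(a, b). C a b)"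
    using g by (auto simp: PiE_iff)
  show "(\<lambda>a\<in>A. \<lambda>b\<in>B. (\<lambda>(a, b)\<in>A \<times> B. g a b) (a, b)) = g"
  proof (rule ext)
    fix a
    show "(\<lambda>a\<in>A. \<lambda>b\<in>B. (\<lambda>(a, b)\<in>A \<times> B. g a b) (a, b)) a = g a"
      using PiE_arb[OF g, of a] PiE_arb[OF PiE_mem[OF g, of a]]
      by (cases "a \<in> A") (auto simp: fun_eq_iff restrict_def)
  qed
qed

text \<open>Backward recursion: \<open>Y i m\<close> is the total weight of all continuations from
  \<open>m\<close> at step \<open>i\<close>, so the sum collapses from its far end.\<close>

lemma transfer_sum:
  fixes T :: "nat \<Rightarrow> 'b \<Rightarrow> 'b \<Rightarrow> 'a::comm_semiring_1"
  assumes "\<And>i m. i < k \<Longrightarrow> m \<in> C i \<Longrightarrow> (\<Sum>m'\<in>C (Suc i). T i m m' * Y (Suc i) m') = Y i m"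
  shows "(\<Sum>g\<in>Pi\<^sub>E {0..k} C. (\<Prod>i<k. T i (g i) (g (Suc i))) * Y k (g k)) = (\<Sum>m\<in>C 0. Y 0 m)"
  using assms
proof (induction k)
  case 0
  have "(\<Sum>g\<in>Pi\<^sub>E (insert 0 {}) C. Y 0 (g 0)) = (\<Sum>m\<in>C 0. Y 0 m)"
    by (subst sum_PiE_insert) auto
  then show ?case by simp
next
  case (Suc k)
  have ins: "{0..Suc k} = insert (Suc k) {0..k}" by auto
  have "(\<Sum>g\<in>Pi\<^sub>E {0..Suc k} C. (\<Prod>i<Suc k. T i (g i) (g (Suc i))) * Y (Suc k) (g (Suc k)))
     = (\<Sum>m\<in>C (Suc k). \<Sum>g\<in>Pi\<^sub>E {0..k} C. (\<Prod>i<k. T i (g i) (g (Suc i))) * (T k (g k) m * Y (Suc k) m))"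
    unfolding ins by (subst sum_PiE_insert) (auto intro!: sum.cong prod.cong simp: mult.assoc)
  also have "\<dots> = (\<Sum>g\<in>Pi\<^sub>E {0..k} C. (\<Prod>i<k. T i (g i) (g (Suc i))) * (\<Sum>m\<in>C (Suc k). T k (g k) m * Y (Suc k) m))"
    unfolding sum_distrib_left by (rule sum.swap)
  also have "\<dots> = (\<Sum>g\<in>Pi\<^sub>E {0..k} C. (\<Prod>i<k. T i (g i) (g (Suc i))) * Y k (g k))"
    by (intro sum.cong refl arg_cong2[where f = "(*)"] Suc.prems) auto
  also have "\<dots> = (\<Sum>m\<in>C 0. Y 0 m)"
    by (rule Suc.IH) (use Suc.prems in auto)
  finally show ?case .
qed

definition row_spins :: "nat \<Rightarrow> nat \<Rightarrow> hspin set" where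
  "row_spins N j = (if j = Suc N then {Plus} else if j = 0 then {Minus} else UNIV)"

lemma UNIV_hspin: "(UNIV :: hspin set) = {Plus, Minus}"
  using hspin.exhaust by auto

lemma sum_row_spins:
  "(\<Sum>h\<in>Pi\<^sub>E {0..Suc N} (row_spins N). \<Prod>j\<in>{0..N}. R_weight x t (h (j + 1)) (m j) (h j) (m' j))
     = row_sum N m m' x t (Suc N) Minus"
proof -
  define T where "T j b a = R_weight x t a (m j) b (m' j)" for j a b
  \<comment> \<open>The weight of the columns from \<open>j\<close> to the left boundary, given spin
    \<open>b\<close> on the right edge of column \<open>j\<close>.\<close>
  define Y where "Y j b = row_sum N m m' x t (Suc N - j) b" for j b
  have "(\<Sum>h\<in>Pi\<^sub>E {0..Suc N} (row_spins N). \<Prod>j\<in>{0..N}. R_weight x t (h (j + 1)) (m j) (h j) (m' j))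
     = (\<Sum>h\<in>Pi\<^sub>E {0..Suc N} (row_spins N). (\<Prod>j<Suc N. T j (h j) (h (Suc j))) * Y (Suc N) (h (Suc N)))"
  proof (intro sum.cong refl)
    fix h assume "h \<in> Pi\<^sub>E {0..Suc N} (row_spins N)"
    then have "h (Suc N) = Plus" by (auto simp: PiE_iff row_spins_def split: if_splits)
    moreover have "{0..N} = {..<Suc N}" by auto
    ultimately show "(\<Prod>j\<in>{0..N}. R_weight x t (h (j + 1)) (m j) (h j) (m' j))
       = (\<Prod>j<Suc N. T j (h j) (h (Suc j))) * Y (Suc N) (h (Suc N))"
      by (simp add: Y_def T_def)
  qed
  also have "\<dots> = (\<Sum>b\<in>row_spins N 0. Y 0 b)"
  proof (rule transfer_sum)
    fix j b assume "j < Suc N"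
    then have "Suc N - j = Suc (N - j)" "N - (N - j) = j" by auto
    then have "Y j b = (\<Sum>a\<in>{Plus, Minus}. T j b a * Y (Suc j) a)"
      by (simp add: Y_def T_def)
    moreover have "Y (Suc N) Minus = 0" by (simp add: Y_def)
    ultimately show "(\<Sum>a\<in>row_spins N (Suc j). T j b a * Y (Suc j) a) = Y j b"
      by (auto simp: row_spins_def UNIV_hspin)
  qed
  finally show ?thesis by (simp add: row_spins_def Y_def)
qed

definition col_spins :: "nat \<Rightarrow> nat \<Rightarrow> (nat \<Rightarrow> nat) \<Rightarrow> nat \<Rightarrow> nat \<Rightarrow> nat set" where
  "col_spins r K mu i j = (if i = 0 then {mu j} else if i = r then {0} else {0..K})"

text \<open>Multiplicities are at most \<open>r\<close> and each row raises a vertical spin by at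
  most 1, so nonzero weight forces spins up to \<open>2 * r\<close>. On this finite box the sum over
  horizontal spins factors into rows.\<close>

lemma Z_R_eq_sum_PiE:
  fixes z :: "nat \<Rightarrow> 'a::field"
  assumes r: "r \<ge> 1" and K: "2 * r \<le> K"
  shows "Z_R r N lam z t = (\<Sum>g\<in>Pi\<^sub>E {0..r} (\<lambda>i. Pi\<^sub>E {0..N} (col_spins r K (mult_of r lam) i)).
     \<Prod>i<r. row_sum N (g i) (g (Suc i)) (z (Suc i)) t (Suc N) Minus)"
proof -
  let ?mu = "mult_of r lam"
  let ?H = "Pi\<^sub>E ({1..r} \<times> {0..Suc N}) (\<lambda>(i, j). row_spins N j)"
  let ?V = "Pi\<^sub>E ({0..r} \<times> {0..N}) (\<lambda>(i, j). col_spins r K ?mu i j)"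
  let ?G = "Pi\<^sub>E {0..r} (\<lambda>i. Pi\<^sub>E {0..N} (col_spins r K ?mu i))"
  let ?S = "{s \<in> states r N lam. boltzmann R_weight r N z t s \<noteq> 0}"
  have fin: "finite (?H \<times> ?V)"
    by (intro finite_SigmaI finite_PiE) (auto simp: row_spins_def col_spins_def UNIV_hspin)
  have in_states: "?H \<times> ?V \<subseteq> states r N lam"
  proof clarify
    fix h v assume h: "h \<in> ?H" and v: "v \<in> ?V"
    have h': "h (i, j) \<in> row_spins N j" if "i \<in> {1..r}" "j \<le> Suc N" for i j
      using PiE_mem[OF h, of "(i, j)"] that by auto
    have v': "v (i, j) \<in> col_spins r K ?mu i j" if "i \<le> r" "j \<le> N" for i j
      using PiE_mem[OF v, of "(i, j)"] that by auto
    have "\<forall>i\<in>{1..r}. h (i, N + 1) = Plus \<and> h (i, 0) = Minus"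
      using h'[of _ "Suc N"] h'[of _ 0] by (auto simp: row_spins_def)
    moreover have "\<forall>j\<in>{0..N}. v (0, j) = ?mu j \<and> v (r, j) = 0"
      using r v'[of 0] v'[of r] by (auto simp: col_spins_def)
    moreover have "h \<in> {1..r} \<times> {0..N + 1} \<rightarrow>\<^sub>E UNIV" "v \<in> {0..r} \<times> {0..N} \<rightarrow>\<^sub>E UNIV"
      using h v by (auto simp: PiE_iff)
    ultimately show "(h, v) \<in> states r N lam" by (simp add: states_def)
  qed
  have supp: "?S \<subseteq> ?H \<times> ?V"
  proof (clarify, rule conjI)
    fix h v assume s: "(h, v) \<in> states r N lam" and nz: "boltzmann R_weight r N z t (h, v) \<noteq> 0"
    show "h \<in> ?H" using s by (auto simp: states_def PiE_iff row_spins_def)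
    have step: "v (i, j) \<le> v (i - 1, j) + 1" if "i \<in> {1..r}" "j \<in> {0..N}" for i j
    proof -
      have "R_weight (z i) t (h (i, j + 1)) (v (i - 1, j)) (h (i, j)) (v (i, j)) \<noteq> 0"
        using nz that by (auto simp: prod_zero_iff)
      then show ?thesis by (rule R_weight_bound)
    qed
    have bound: "v (i, j) \<le> ?mu j + i" if "i \<le> r" "j \<in> {0..N}" for i j
      using that(1)
    proof (induction i)
      case 0
      then show ?case using s that(2) by (auto simp: states_def)
    next
      case (Suc i)
      then show ?case using step[of "Suc i" j] that(2) by auto
    qed
    have "card {k \<in> {1..r}. lam k = j} \<le> card {1..r}" for j by (rule card_mono) auto
    then have mu: "?mu j \<le> r" for j by (simp add: mult_of_def)
    have "v (i, j) \<le> K" if "i \<le> r" "j \<in> {0..N}" for i j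
      using bound[OF that] mu[of j] that(1) K by linarith
    then show "v \<in> ?V"
      using s by (auto simp: states_def PiE_iff col_spins_def)
  qed
  have "Z_R r N lam z t = sum (boltzmann R_weight r N z t) (?H \<times> ?V)"
    unfolding Z_R_def partition_function_def
    by (rule sum.mono_neutral_left[OF fin supp]) (use in_states in auto)
  also have "\<dots> = (\<Sum>v\<in>?V. \<Sum>h\<in>?H. boltzmann R_weight r N z t (h, v))"
    unfolding sum.cartesian_product' by (rule sum.swap)
  also have "\<dots> = (\<Sum>g\<in>?G. \<Sum>h\<in>Pi\<^sub>E {1..r} (\<lambda>i. Pi\<^sub>E {0..Suc N} (row_spins N)).
      \<Prod>i\<in>{1..r}. \<Prod>j\<in>{0..N}. R_weight (z i) t (h i (j + 1)) (g (i - 1) j) (h i j) (g i j))"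
    unfolding sum_PiE_curry boltzmann.simps
    by (intro sum.cong prod.cong refl) auto
  also have "\<dots> = (\<Sum>g\<in>?G. \<Prod>i\<in>{1..r}. row_sum N (g (i - 1)) (g i) (z i) t (Suc N) Minus)"
  proof (intro sum.cong refl)
    fix g :: "nat \<Rightarrow> nat \<Rightarrow> nat"
    show "(\<Sum>h\<in>Pi\<^sub>E {1..r} (\<lambda>i. Pi\<^sub>E {0..Suc N} (row_spins N)).
      \<Prod>i\<in>{1..r}. \<Prod>j\<in>{0..N}. R_weight (z i) t (h i (j + 1)) (g (i - 1) j) (h i j) (g i j))
      = (\<Prod>i\<in>{1..r}. row_sum N (g (i - 1)) (g i) (z i) t (Suc N) Minus)"
      unfolding sum_row_spins[symmetric]
      by (rule prod_sum_PiE[symmetric]) (auto intro!: finite_PiE simp: row_spins_def UNIV_hspin)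
  qed
  also have "\<dots> = (\<Sum>g\<in>?G. \<Prod>i<r. row_sum N (g i) (g (Suc i)) (z (Suc i)) t (Suc N) Minus)"
    by (simp only: One_nat_def prod.atLeast1_atMost_eq diff_Suc_Suc diff_zero)
  finally show ?thesis .
qed

lemma HL_R_cong:
  assumes "\<And>i. i \<in> {1..n} \<Longrightarrow> lam i = lam' i"
  shows "HL_R n lam z t = HL_R n lam' z t"
  unfolding HL_R_def HL_summand_def using assms by (intro sum.cong refl arg_cong2[where f = "(*)"] prod.cong) auto

section \<open>Recovering a partition from its multiplicities\<close>

lemma top_count_mult_of:
  assumes "\<And>k. k \<in> {1..r} \<Longrightarrow> lam k \<le> N"
  shows "top_count N (mult_of r lam) j = card {k \<in> {1..r}. j \<le> lam k}"
proof -
  have "top_count N (mult_of r lam) j = card (\<Union>i\<in>{j..N}. {k \<in> {1..r}. lam k = i})"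
    unfolding top_count_def mult_of_def by (subst card_UN_disjoint) auto
  also have "(\<Union>i\<in>{j..N}. {k \<in> {1..r}. lam k = i}) = {k \<in> {1..r}. j \<le> lam k}"
    using assms by auto
  finally show ?thesis .
qed

text \<open>The indices of parts of size at least \<open>j\<close> form an initial segment, so there
  are at least \<open>k\<close> of them exactly if \<open>j <= lam k\<close>.\<close>

lemma part_mult_of:
  assumes anti: "antimono_on {1..r} lam" and N: "lam 1 \<le> N" and k: "k \<in> {1..r}"
  shows "part N (mult_of r lam) k = lam k"
proof -
  have anti': "lam l \<le> lam i" if "i \<in> {1..r}" "l \<in> {1..r}" "i \<le> l" for i l
    using anti that by (auto simp: monotone_on_def)
  have le: "lam l \<le> N" if "l \<in> {1..r}" for l
    using anti'[of 1 l] that N by auto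
  have count: "top_count N (mult_of r lam) j = card {k \<in> {1..r}. j \<le> lam k}" for j
    by (rule top_count_mult_of) (rule le)
  have "k \<le> top_count N (mult_of r lam) j \<longleftrightarrow> j \<le> lam k" for j
  proof
    assume "j \<le> lam k"
    then have "{1..k} \<subseteq> {l \<in> {1..r}. j \<le> lam l}" using anti'[of _ k] k by (auto intro: order_trans)
    from card_mono[OF _ this] show "k \<le> top_count N (mult_of r lam) j"
      unfolding count by simp
  next
    assume *: "k \<le> top_count N (mult_of r lam) j"
    show "j \<le> lam k"
    proof (rule ccontr)
      assume "\<not> j \<le> lam k"
      then have "{l \<in> {1..r}. j \<le> lam l} \<subseteq> {1..<k}"
        using anti'[of k] k by (auto simp: not_le) (meson le_less_trans not_le order.trans)
      from card_mono[OF _ this] have "top_count N (mult_of r lam) j \<le> k - 1"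
        unfolding count by simp
      with * k show False by auto
    qed
  qed
  then have "part N (mult_of r lam) k = card {j \<in> {1..N}. j \<le> lam k}" by (simp add: part_def)
  also have "{j \<in> {1..N}. j \<le> lam k} = {1..lam k}" using le[OF k] by auto
  finally show ?thesis by simp
qed

lemma Z_R_eq_HL_R:
  fixes z :: "nat \<Rightarrow> 'a::field"
  assumes r: "r \<ge> 1" and anti: "antimono_on {1..r} lam" and N: "N \<ge> lam 1"
    and inj: "inj_on z {1..r}" and t: "t \<noteq> 1"
  shows "Z_R r N lam z t = HL_R r lam z t"
proof -
  define K where "K = 2 * r"
  define C where "C i = Pi\<^sub>E {0..N} (col_spins r K (mult_of r lam) i)" for i
  define T where "T i m m' = row_sum N m m' (z (Suc i)) t (Suc N) Minus" for i m m'
  \<comment> \<open>The value of the rows below row \<open>i\<close> with top spins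
    \<open>m\<close>. Each row removes one particle, so it is 0 unless the particles match the
    remaining rows in number.\<close>
  define Y where "Y i m = (if top_count N m 0 = r - i then HL_R (r - i) (part N m) (\<lambda>k. z (k + i)) t else 0)"
    for i m
  have last: "Y r m = of_bool (\<forall>j\<le>N. m j = 0)" for m
    by (auto simp: Y_def top_count_def HL_R_def HL_summand_def)
  have "Z_R r N lam z t = (\<Sum>g\<in>Pi\<^sub>E {0..r} C. \<Prod>i<r. T i (g i) (g (Suc i)))"
    unfolding C_def T_def by (rule Z_R_eq_sum_PiE[OF r]) (simp add: K_def)
  also have "\<dots> = (\<Sum>g\<in>Pi\<^sub>E {0..r} C. (\<Prod>i<r. T i (g i) (g (Suc i))) * Y r (g r))"
  proof (intro sum.cong refl)
    fix g assume "g \<in> Pi\<^sub>E {0..r} C"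
    then have "g r \<in> C r" by auto
    then have "Y r (g r) = 1" using r by (auto simp: last C_def col_spins_def PiE_iff)
    then show "(\<Prod>i<r. T i (g i) (g (Suc i))) = (\<Prod>i<r. T i (g i) (g (Suc i))) * Y r (g r)" by simp
  qed
  also have "\<dots> = (\<Sum>m\<in>C 0. Y 0 m)"
  proof (rule transfer_sum)
    fix i m assume i: "i < r" and m: "m \<in> C i"
    let ?V = "{0..N} \<rightarrow>\<^sub>E {0..K}"
    \<comment> \<open>The bottom boundary allows only spins 0, but \<open>Y r\<close> vanishes on
      all others, so the full box of the branching rule may be used.\<close>
    have "(\<Sum>m'\<in>C (Suc i). T i m m' * Y (Suc i) m') = (\<Sum>m'\<in>?V. T i m m' * Y (Suc i) m')"
    proof (cases "Suc i = r")
      case True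
      have "C r \<subseteq> ?V" using r by (auto simp: C_def col_spins_def PiE_iff)
      moreover have "Y r m' = 0" if "m' \<in> ?V - C r" for m'
        using that r by (auto simp: last C_def col_spins_def PiE_iff)
      ultimately show ?thesis
        unfolding True by (intro sum.mono_neutral_left) (auto intro!: finite_PiE)
    next
      case False
      then have "C (Suc i) = ?V" unfolding C_def by (intro PiE_cong) (auto simp: col_spins_def)
      then show ?thesis by simp
    qed
    also have "\<dots> = Y i m"
    proof (cases "top_count N m 0 = r - i")
      case False
      have "T i m m' * Y (Suc i) m' = 0" for m'
      proof (cases "T i m m' = 0")
        case nz: False
        have "top_count N m 0 = Suc (top_count N m' 0)"
          using row_sum_conserves[OF order.refl nz[unfolded T_def]] by simp
        then have "top_count N m' 0 \<noteq> r - Suc i" using False i by auto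
        then show ?thesis by (simp add: Y_def)
      qed simp
      then show ?thesis using False by (simp only: sum.neutral_const) (simp add: Y_def)
    next
      case True
      obtain n where n: "r - i = Suc n" "r - Suc i = n" using i by (metis Suc_diff_Suc)
      have "m j < K" if "j \<le> N" for j
      proof -
        have "m j \<le> top_count N m 0"
          unfolding top_count_def using that by (intro member_le_sum) auto
        then show ?thesis using True r by (simp add: K_def)
      qed
      moreover have "z (k + i) \<noteq> z (1 + i)" if "k \<in> {2..Suc n}" for k
      proof
        assume eq: "z (k + i) = z (1 + i)"
        have "k + i \<in> {1..r}" "1 + i \<in> {1..r}" using that n i by auto
        from inj_onD[OF inj eq this] that show False by simp
      qed
      ultimately have "Y i m = (\<Sum>m'\<in>?V. row_sum N m m' (z (1 + i)) t (Suc N) Minus *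
         HL_R n (part N m') ((\<lambda>k. z (k + i)) \<circ> Suc) t)"
        using HL_R_branching[of n "\<lambda>k. z (k + i)" t N m K] t True by (simp add: Y_def n)
      also have "\<dots> = (\<Sum>m'\<in>?V. T i m m' * Y (Suc i) m')"
      proof (intro sum.cong refl)
        fix m' :: "nat \<Rightarrow> nat"
        have "top_count N m' 0 = n" if "T i m m' \<noteq> 0"
          using row_sum_conserves[OF order.refl that[unfolded T_def]] True n by simp
        then show "row_sum N m m' (z (1 + i)) t (Suc N) Minus * HL_R n (part N m') ((\<lambda>k. z (k + i)) \<circ> Suc) t
            = T i m m' * Y (Suc i) m'"
          by (cases "T i m m' = 0") (auto simp: T_def Y_def n o_def)
      qed
      finally show ?thesis by simp
    qed
    finally show "(\<Sum>m'\<in>C (Suc i). T i m m' * Y (Suc i) m') = Y i m" .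
  qed
  also have "\<dots> = HL_R r lam z t"
  proof -
    define m0 where "m0 = restrict (mult_of r lam) {0..N}"
    have "m = m0" if "m \<in> C 0" for m
      using PiE_mem[OF that[unfolded C_def]] PiE_arb[OF that[unfolded C_def]]
      by (auto simp: m0_def col_spins_def fun_eq_iff)
    moreover have "m0 \<in> C 0" by (auto simp: C_def m0_def col_spins_def)
    ultimately have C0: "C 0 = {m0}" by blast
    have tc: "top_count N m0 j = top_count N (mult_of r lam) j" for j
      by (rule top_count_cong) (simp add: m0_def)
    have le: "lam k \<le> N" if "k \<in> {1..r}" for k
      using anti N that r by (force simp: monotone_on_def)
    have "top_count N (mult_of r lam) 0 = card {k \<in> {1..r}. 0 \<le> lam k}"
      by (rule top_count_mult_of) (rule le)
    also have "{k \<in> {1..r}. 0 \<le> lam k} = {1..r}" by auto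
    finally have "top_count N m0 0 = r" by (simp add: tc)
    moreover have "part N m0 k = lam k" if "k \<in> {1..r}" for k
      using part_mult_of[OF anti N that] by (simp add: part_def tc)
    ultimately show ?thesis
      by (auto simp: C0 Y_def intro: HL_R_cong)
  qed
  finally show ?thesis .
qed

subsection \<open>The \<open>P\<close>-partition function\<close>

text \<open>The \<open>t\<close>-analogue of the factorial of \<open>n\<close>; \<open>HL_v\<close>
  is its product over the multiplicities.\<close>

definition col_factor :: "'a::field \<Rightarrow> nat \<Rightarrow> 'a" where
  "col_factor t n = (\<Prod>k\<in>{1..n}. (1 - t ^ k) / (1 - t))"

lemma col_factor_nz: "(\<And>k. k \<ge> 1 \<Longrightarrow> t ^ k \<noteq> 1) \<Longrightarrow> col_factor t n \<noteq> 0"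
  using power_one_right[of t] by (fastforce simp: col_factor_def)

lemma R_weight_P_weight:
  assumes "t \<noteq> 1"
  shows "R_weight z t a n b n' * col_factor t n' = P_weight z t a n b n' * col_factor t n"
  using assms by (cases a; cases b) (auto simp: col_factor_def field_simps)

lemma boltzmann_R_P:
  fixes z :: "nat \<Rightarrow> 'a::field"
  assumes t: "\<And>k. k \<ge> 1 \<Longrightarrow> t ^ k \<noteq> 1" and r: "r \<ge> 1" and s: "(h, v) \<in> states r N lam"
  shows "boltzmann R_weight r N z t (h, v)
    = boltzmann P_weight r N z t (h, v) * (\<Prod>j\<in>{0..N}. col_factor t (mult_of r lam j))"
proof -
  note nz = col_factor_nz[of t, OF t]
  have t1: "t \<noteq> 1" using t[of 1] by simp
  define D where "D i = (\<Prod>j\<in>{0..N}. col_factor t (v (i, j)))" for i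
  define W where "W wt i = (\<Prod>j\<in>{0..N}. wt (z i) t (h (i, j + 1)) (v (i - 1, j)) (h (i, j)) (v (i, j)))"
    for wt :: "'a vertex_weight" and i
  have row: "W R_weight i * D i = W P_weight i * D (i - 1)" for i
    unfolding W_def D_def prod.distrib[symmetric] by (intro prod.cong refl R_weight_P_weight t1)
  have "(\<Prod>i\<in>{1..k}. W R_weight i) * D k = (\<Prod>i\<in>{1..k}. W P_weight i) * D 0" for k
  proof (induction k)
    case (Suc k)
    have "(\<Prod>i\<in>{1..Suc k}. W R_weight i) * D (Suc k)
        = ((\<Prod>i\<in>{1..k}. W R_weight i) * D k) * W P_weight (Suc k)"
      using row[of "Suc k"] by (simp add: ac_simps)
    then show ?case by (simp only: Suc.IH) (simp add: ac_simps)
  qed simp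
  from this[of r] have "boltzmann R_weight r N z t (h, v) * D r = boltzmann P_weight r N z t (h, v) * D 0"
    by (simp add: W_def)
  moreover have "D r = 1"
    using s by (auto simp: D_def states_def col_factor_def)
  moreover have "D 0 = (\<Prod>j\<in>{0..N}. col_factor t (mult_of r lam j))"
    unfolding D_def using s by (intro prod.cong) (auto simp: states_def)
  ultimately show ?thesis by simp
qed

text \<open>The factor is a nonzero constant, so both sums have the same support.\<close>

lemma Z_R_Z_P:
  fixes z :: "nat \<Rightarrow> 'a::field"
  assumes t: "\<And>k. k \<ge> 1 \<Longrightarrow> t ^ k \<noteq> 1" and r: "r \<ge> 1"
  shows "Z_R r N lam z t = Z_P r N lam z t * (\<Prod>j\<in>{0..N}. col_factor t (mult_of r lam j))"
proof -
  let ?c = "\<Prod>j\<in>{0..N}. col_factor t (mult_of r lam j)"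
  have c: "?c \<noteq> 0" using col_factor_nz[of t, OF t] by simp
  have eq: "boltzmann R_weight r N z t s = boltzmann P_weight r N z t s * ?c" if "s \<in> states r N lam" for s
    using boltzmann_R_P[OF t r, of "fst s" "snd s"] that by simp
  show ?thesis
    unfolding Z_R_def Z_P_def partition_function_def sum_distrib_right
    by (rule sum.cong) (use c eq in auto)
qed

lemma Z_P_eq_HL_P:
  fixes z :: "nat \<Rightarrow> 'a::field"
  assumes r: "r \<ge> 1" and anti: "antimono_on {1..r} lam" and N: "N \<ge> lam 1"
    and inj: "inj_on z {1..r}" and t: "\<And>k. k \<ge> 1 \<Longrightarrow> t ^ k \<noteq> 1"
  shows "Z_P r N lam z t = HL_P r lam z t"
proof -
  let ?c = "\<Prod>j\<in>{0..N}. col_factor t (mult_of r lam j)"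
  have c: "?c \<noteq> 0" using col_factor_nz[of t, OF t] by simp
  \<comment> \<open>Columns beyond \<open>lam 1\<close> are empty and contribute 1, which reduces
    the product up to \<open>N\<close> to \<open>HL_v\<close>.\<close>
  have "mult_of r lam j = 0" if "j > lam 1" for j
  proof -
    have "lam k \<le> lam 1" if "k \<in> {1..r}" for k
      using anti that r by (auto simp: monotone_on_def)
    then have "{k \<in> {1..r}. lam k = j} = {}" using that by fastforce
    then show ?thesis by (simp add: mult_of_def)
  qed
  then have "?c = HL_v r lam t"
    unfolding HL_v_def col_factor_def using N by (intro prod.mono_neutral_right) auto
  moreover have "Z_P r N lam z t * ?c = HL_R r lam z t"
    using Z_R_Z_P[OF t r, of N lam z] Z_R_eq_HL_R[OF r anti N inj] t[of 1] by simp
  ultimately show ?thesis using c by (simp add: HL_P_def field_simps)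
qed

section \<open>Genericity of the indeterminates\<close>

lemma inj_indet: "inj (indet :: nat \<Rightarrow> 'k::idom ratfun)"
proof (rule injI)
  fix a b assume "(indet a :: 'k ratfun) = indet b"
  then have "Poly_Mapping.single (Poly_Mapping.single a (1::nat)) (1::'k)
      = Poly_Mapping.single (Poly_Mapping.single b 1) 1"
    by (simp add: indet_def eq_fract)
  then have "Poly_Mapping.single a (1::nat) = Poly_Mapping.single b 1"
    by (metis lookup_single_eq lookup_single_not_eq zero_neq_one)
  then show "a = b"
    by (metis lookup_single_eq lookup_single_not_eq zero_neq_one)
qed

lemma indet_power:
  "(indet i :: 'k::idom ratfun) ^ k = Fract (Poly_Mapping.single (Poly_Mapping.single i k) 1) 1"
proof (induction k)
  case 0
  then show ?case by (simp add: One_fract_def)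
next
  case (Suc k)
  then show ?case by (simp add: indet_def mult_single flip: single_add)
qed

lemma indet_power_neq_1:
  assumes "k \<ge> 1"
  shows "(indet i :: 'k::idom ratfun) ^ k \<noteq> 1"
proof
  assume "(indet i :: 'k ratfun) ^ k = 1"
  then have "Poly_Mapping.single (Poly_Mapping.single i k) (1::'k) = 1"
    by (simp add: indet_power One_fract_def eq_fract)
  then have "Poly_Mapping.single (Poly_Mapping.single i k) (1::'k) = Poly_Mapping.single 0 1"
    by simp
  then have "Poly_Mapping.single i k = 0"
    by (metis lookup_single_eq lookup_single_not_eq zero_neq_one)
  then show False
    using assms by (metis lookup_single_eq lookup_zero not_one_le_zero)
qed

theorem theorem5p4:
  fixes r N :: nat and lam :: "nat \<Rightarrow> nat"
  assumes "r \<ge> 1"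
    and "antimono_on {1..r} lam"
    and "N \<ge> lam 1"
  shows "Z_P r N lam zvar (tvar :: 'k::idom ratfun) = HL_P r lam zvar tvar \<and>
         Z_R r N lam zvar (tvar :: 'k ratfun) = HL_R r lam zvar tvar"
proof -
  have inj: "inj_on (zvar :: nat \<Rightarrow> 'k ratfun) {1..r}"
    using inj_indet by (auto simp: zvar_def inj_on_def)
  have t: "(tvar :: 'k ratfun) ^ k \<noteq> 1" if "k \<ge> 1" for k
    unfolding tvar_def by (rule indet_power_neq_1[OF that])
  then have "(tvar :: 'k ratfun) \<noteq> 1" by (metis power_one_right order.refl)
  with Z_P_eq_HL_P[OF assms inj t] Z_R_eq_HL_R[OF assms inj] show ?thesis by blast
qed

end
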